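(* Let $\{\theta_k,\ k\ge0\}$ be the stochastic process generated by the coupled recursion described in the context, with step-size $\gamma>0$, where the sequence of positive numbers $\{\zeta_k,\ k\ge1\}$ satisfies $\sum_{k\ge1}\zeta_k=\infty$ and $\sum_{k\ge1}\zeta_k^2<\infty$. Fix $0<\ell\le\psi<\infty$. Suppose that $\hat\theta,\theta_0\in\mathcal{M}_+(\ell,\psi)$ and $\gamma\le\ell^2$. Then, almost surely on the event $$\left\{\tau(\ell,\psi)=+\infty\ \text{ and }\ \{\theta_k\}\text{ converges}\right\},$$ we have $\lim_{k\to\infty}\theta_k=\hat\theta$.
   Context: $\mathcal{M}$ is the set of real symmetric $p\times p$ matrices with inner product $\langle A,B\rangle=\mathrm{Tr}(A'B)$ and Frobenius norm $\|A\|_F$; $\mathcal{M}_+\subset\mathcal{M}$ is the set of positive definite matrices, and $\lambda_{\min},\lambda_{\max}$ denote smallest and largest eigenvalues. $S$ is a fixed $p\times p$ symmetric positive semidefinite matrix; $\lambda>0$ and $\alpha\in(0,1]$ are fixed. For $0<\ell\le\psi$, $\mathcal{M}_+(\ell,\psi)=\{\theta\in\mathcal{M}_+:\lambda_{\min}(\theta)\ge\ell,\ \lambda_{\max}(\theta)\le\psi\}$. Let $f(\theta)=-\log\det\theta+\mathrm{Tr}(\theta S)$ for $\theta\in\mathcal{M}_+$, $g_\alpha(\theta)=\sum_{i,j}\left(\alpha\lambda|\theta_{ij}|+\frac{1-\alpha}{2}\lambda\theta_{ij}^2\right)$, $\phi_\alpha=f+g_\alpha$, and let $\hat\theta$ be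 the (unique) minimizer of $\phi_\alpha$ over $\mathcal{M}_+$. For $\theta\in\mathcal{M}$, $\mathrm{Prox}_\gamma(\theta;\alpha)=\operatorname{argmin}_{u\in\mathcal{M}}\left\{g_\alpha(u)+\frac{1}{2\gamma}\|u-\theta\|_F^2\right\}$. The process (the paper's Algorithm 3): $N\ge1$ is a fixed integer, $\theta_0,\Sigma_0\in\mathcal{M}_+$ are given. For $k\ge0$, given $\theta_k$ and $\Sigma_k$ (and the past), generate $z_1,\ldots,z_N$ i.i.d. from $\mathbf{N}(0,\theta_k^{-1})$ on $\mathbb{R}^p$, and set $$\Sigma_{k+1}=\Sigma_k+\zeta_{k+1}\left(\frac1N\sum_{i=1}^Nz_iz_i'-\Sigma_k\right),\qquad \theta_{k+1}=\mathrm{Prox}_\gamma\left(\theta_k-\gamma(S-\Sigma_{k+1});\alpha\right).$$ (The algorithm restarts with a smaller step-size if $\theta_{k+1}$ is not positive definite; this never happens on $\{\tau(\ell,\psi)=\infty\}$, so the process may be considered only up to the first exit from $\mathcal{M}_+$.) Finally $\tau(\ell,\psi)=\inf\{k\ge0:\theta_k\notin\mathcal{M}_+(\ell,\psi)\}$, with $\inf\emptyset=\infty$. *)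

theory Defs
  imports "HOL-Probability.Probability"
begin

text \<open>On \<open>real ^ 'n ^ 'n\<close> the library's \<open>norm\<close> is the Frobenius norm, and its topology
  and Borel sets are those of the \<open>CARD('n)\<^sup>2\<close>-dimensional Euclidean space.\<close>

definition sym_mats :: "(real ^ 'n ^ 'n) set" where
  "sym_mats = {A. transpose A = A}"

definition pos_def_mats :: "(real ^ 'n ^ 'n) set" where
  "pos_def_mats = {A \<in> sym_mats. \<forall>x. x \<noteq> 0 \<longrightarrow> 0 < x \<bullet> (A *v x)}"

definition pos_semidef_mats :: "(real ^ 'n ^ 'n) set" where
  "pos_semidef_mats = {A \<in> sym_mats. \<forall>x. 0 \<le> x \<bullet> (A *v x)}"

definition eigenvalues :: "real ^ 'n ^ 'n \<Rightarrow> real set" where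
  "eigenvalues A = {c. \<exists>v. v \<noteq> 0 \<and> A *v v = c *\<^sub>R v}"

text \<open>Only used for symmetric matrices, whose set of (real) eigenvalues is finite and nonempty.\<close>

definition lambda_min :: "real ^ 'n ^ 'n \<Rightarrow> real" where
  "lambda_min A = Min (eigenvalues A)"

definition lambda_max :: "real ^ 'n ^ 'n \<Rightarrow> real" where
  "lambda_max A = Max (eigenvalues A)"

definition pos_def_between :: "real \<Rightarrow> real \<Rightarrow> (real ^ 'n ^ 'n) set" where
  "pos_def_between l u = {A \<in> pos_def_mats. l \<le> lambda_min A \<and> lambda_max A \<le> u}"

definition outer_square :: "real ^ 'n \<Rightarrow> real ^ 'n ^ 'n" where
  "outer_square z = (\<chi> i j. z $ i * z $ j)"

definition neg_loglik :: "real ^ 'n ^ 'n \<Rightarrow> real ^ 'n ^ 'n \<Rightarrow> real" where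
  "neg_loglik S A = - ln (det A) + trace (A ** S)"

definition elastic_net :: "real \<Rightarrow> real \<Rightarrow> real ^ 'n ^ 'n \<Rightarrow> real" where
  "elastic_net lam \<alpha> A =
     (\<Sum>i\<in>UNIV. \<Sum>j\<in>UNIV. \<alpha> * lam * \<bar>A $ i $ j\<bar> + (1 - \<alpha>) / 2 * lam * (A $ i $ j)\<^sup>2)"

definition objective :: "real ^ 'n ^ 'n \<Rightarrow> real \<Rightarrow> real \<Rightarrow> real ^ 'n ^ 'n \<Rightarrow> real" where
  "objective S lam \<alpha> A = neg_loglik S A + elastic_net lam \<alpha> A"

definition prox :: "real \<Rightarrow> real \<Rightarrow> real \<Rightarrow> real ^ 'n ^ 'n \<Rightarrow> real ^ 'n ^ 'n" where
  "prox lam \<alpha> \<gamma> A =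
     arg_min (\<lambda>U. elastic_net lam \<alpha> U + 1 / (2 * \<gamma>) * (norm (U - A))\<^sup>2) (\<lambda>U. U \<in> sym_mats)"

text \<open>\<open>V\<close> is the covariance matrix, assumed positive definite whenever this is used.\<close>

definition mv_normal :: "real ^ 'n \<Rightarrow> real ^ 'n ^ 'n \<Rightarrow> (real ^ 'n) measure" where
  "mv_normal m V = density lborel
     (\<lambda>x. ennreal (exp (- ((x - m) \<bullet> (matrix_inv V *v (x - m))) / 2)
                     / sqrt ((2 * pi) ^ CARD('n) * det V)))"

definition exit_time :: "'s set \<Rightarrow> (nat \<Rightarrow> 's) \<Rightarrow> enat" where
  "exit_time A X = Inf (enat ` {k. X k \<notin> A})"

text \<open>\<open>F k\<close> is the information available before the draws \<open>z k 1, \<dots>, z k N\<close> that produce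
  \<open>\<Sigma> (Suc k)\<close> and \<open>\<theta> (Suc k)\<close>. Since \<open>mv_normal 0 (matrix_inv (\<theta> k))\<close> only makes sense for
  positive definite \<open>\<theta> k\<close>, the sampling law and the recursion are imposed only as long as
  \<open>\<theta> 0, \<dots>, \<theta> k\<close> are positive definite; after the first exit the (adapted) process is
  arbitrary. The equation in \<open>sampling\<close> says that, given \<open>F k\<close>, the draws are independent
  with common law \<open>mv_normal 0 (matrix_inv (\<theta> k))\<close>.\<close>

locale stoch_prox_process =
  prob_space M + filtration "space M" F
  for M :: "'w measure" and F :: "nat \<Rightarrow> 'w measure" +
  fixes S :: "real ^ 'n ^ 'n"
    and lam \<alpha> \<gamma> :: real
    and \<zeta> :: "nat \<Rightarrow> real"
    and N :: nat
    and \<theta>0 \<Sigma>0 :: "real ^ 'n ^ 'n"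
    and z :: "nat \<Rightarrow> nat \<Rightarrow> 'w \<Rightarrow> real ^ 'n"
    and \<Sigma> \<theta> :: "nat \<Rightarrow> 'w \<Rightarrow> real ^ 'n ^ 'n"
  assumes F_subalgebra: "\<And>k. subalgebra M (F k)"
    and z_measurable: "\<And>k i. i \<in> {1..N} \<Longrightarrow> z k i \<in> borel_measurable (F (Suc k))"
    and \<Sigma>_adapted: "\<And>k. \<Sigma> k \<in> borel_measurable (F k)"
    and \<theta>_adapted: "\<And>k. \<theta> k \<in> borel_measurable (F k)"
    and \<Sigma>_init: "\<And>\<omega>. \<omega> \<in> space M \<Longrightarrow> \<Sigma> 0 \<omega> = \<Sigma>0"
    and \<theta>_init: "\<And>\<omega>. \<omega> \<in> space M \<Longrightarrow> \<theta> 0 \<omega> = \<theta>0"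
    and sampling: "\<And>k A. (\<And>i. i \<in> {1..N} \<Longrightarrow> A i \<in> sets borel) \<Longrightarrow>
          AE \<omega> in M. (\<forall>j\<le>k. \<theta> j \<omega> \<in> pos_def_mats) \<longrightarrow>
            real_cond_exp M (F k) (indicator {\<omega>' \<in> space M. \<forall>i\<in>{1..N}. z k i \<omega>' \<in> A i}) \<omega>
              = (\<Prod>i\<in>{1..N}. measure (mv_normal 0 (matrix_inv (\<theta> k \<omega>))) (A i))"
    and \<Sigma>_step: "\<And>k \<omega>. \<omega> \<in> space M \<Longrightarrow> \<forall>j\<le>k. \<theta> j \<omega> \<in> pos_def_mats \<Longrightarrow>
          \<Sigma> (Suc k) \<omega> = \<Sigma> k \<omega> + \<zeta> (Suc k) *\<^sub>R
            ((1 / real N) *\<^sub>R (\<Sum>i\<in>{1..N}. outer_square (z k i \<omega>)) - \<Sigma> k \<omega>)"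
    and \<theta>_step: "\<And>k \<omega>. \<omega> \<in> space M \<Longrightarrow> \<forall>j\<le>k. \<theta> j \<omega> \<in> pos_def_mats \<Longrightarrow>
          \<theta> (Suc k) \<omega> = prox lam \<alpha> \<gamma> (\<theta> k \<omega> - \<gamma> *\<^sub>R (S - \<Sigma> (Suc k) \<omega>))"

end

theory Submission
  imports Defs "HOL-Real_Asymp.Real_Asymp"
begin

text \<open>Given the past, \<open>(u \<bullet> z)\<^sup>2\<close> has mean \<open>u \<bullet> \<theta>\<^sub>k\<^sup>-\<^sup>1 u\<close>. While the iterates stay in
  \<open>pos_def_between l \<psi>\<close>, the noise in the recursion for \<open>u \<bullet> \<Sigma>\<^sub>k u\<close> is therefore a sequence of
  martingale differences with variances \<open>O(\<zeta>\<^sub>k\<^sup>2)\<close>, so its series converges almost surely. Since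
  \<open>\<Sum>\<zeta>\<^sub>k = \<infinity>\<close>, the averages \<open>\<Sigma>\<^sub>k\<close> then converge to \<open>\<Theta>\<^sup>-\<^sup>1\<close> whenever \<open>\<theta>\<^sub>k \<longlonglongrightarrow> \<Theta>\<close>. Passing to the
  limit in the variational inequality for the proximal step, \<open>\<Theta>\<close> is a fixed point of the exact
  proximal gradient map; by convexity of the penalty and strict concavity of \<open>ln det\<close> this makes
  it the unique minimizer.\<close>

section \<open>The spectral theorem and positive definite matrices\<close>

text \<open>The event concerns the whole trajectory and the limit is random, so neither can be
  conditioned on. The noise is therefore multiplied by the indicator of
  \<open>stay l \<psi> k\<close>, which is decided by \<open>F k\<close>. The martingale estimates
  then hold on the whole space with deterministic bounds (the lower eigenvalue bound l controls all
  variances), and on the event itself the cut-off is invisible. The exceptional null set must not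
  depend on the limit \<Theta>. Only quadratic forms in finitely many vectors u are tracked;
  symmetry recovers the matrix from them, and what follows is pathwise. \<open>sampling\<close>
  speaks only of conditional probabilities of products of Borel sets. Moments are reached by
  restricting M to a set H of \<open>F k\<close>: the image of this restriction under a draw is a
  mixture of normal laws, an identity between measures on \<open>real ^ 'n\<close> in which
  arbitrary nonnegative functions can be integrated. Fourth moments enter because the noise is
  quadratic in the Gaussian draws, so its variance is of fourth order.\<close>

lemma self_adjoint_eigenvector:
  fixes f :: "'a::euclidean_space \<Rightarrow> 'a"
  assumes f: "linear f" and V: "subspace V" and inv: "f ` V \<subseteq> V"
    and adj: "\<And>x y. x \<in> V \<Longrightarrow> y \<in> V \<Longrightarrow> x \<bullet> f y = f x \<bullet> y"
    and nz: "V \<noteq> {0}"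
  shows "\<exists>v\<in>V. \<exists>c. norm v = 1 \<and> f v = c *\<^sub>R v"
proof -
  interpret linear f by (rule f)
  obtain w where w: "w \<in> V" "w \<noteq> 0"
    using nz subspace_0[OF V] by blast
  define K where "K = V \<inter> sphere 0 1"
  have "compact K" unfolding K_def
    by (intro closed_Int_compact closed_subspace V compact_sphere)
  moreover have "w /\<^sub>R norm w \<in> K"
    using w V by (simp add: K_def subspace_mul)
  moreover have "continuous_on K (\<lambda>x. x \<bullet> f x)"
    by (intro continuous_intros linear_continuous_on_compose[OF continuous_on_id] f)
  ultimately obtain v where v: "v \<in> K" and min: "\<And>x. x \<in> K \<Longrightarrow> v \<bullet> f v \<le> x \<bullet> f x"
    using continuous_attains_inf[of K "\<lambda>x. x \<bullet> f x"] by auto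
  define c where "c = v \<bullet> f v"
  have vV: "v \<in> V" and nv: "norm v = 1" using v by (auto simp: K_def)
  have vv: "v \<bullet> v = 1" using nv by (simp add: norm_eq_1)
  have ray: "c * (x \<bullet> x) \<le> x \<bullet> f x" if "x \<in> V" for x
  proof (cases "x = 0")
    case False
    have "x /\<^sub>R norm x \<in> K" using that False V by (simp add: K_def subspace_mul)
    from min[OF this] have "c \<le> (x \<bullet> f x) / (norm x)\<^sup>2"
      by (simp add: c_def scale power2_eq_square divide_simps)
    then show ?thesis using False by (simp add: field_simps power2_norm_eq_inner)
  qed (simp add: zero)
  \<comment> \<open>The residual lies in V because V is invariant, so it is an admissible direction
    of variation; by the choice of c it is orthogonal to v.\<close>
  define r where "r = f v - c *\<^sub>R v"
  have rV: "r \<in> V" unfolding r_def using vV inv V by (auto intro!: subspace_diff subspace_mul)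
  have vr: "v \<bullet> r = 0" by (simp add: r_def inner_diff_right c_def[symmetric] vv)
  have fvr: "f v \<bullet> r = r \<bullet> r" using vr by (simp add: r_def inner_diff_left)
  have vfr: "v \<bullet> f r = r \<bullet> r" using adj[OF vV rV] fvr by simp
  \<comment> \<open>First variation of the Rayleigh quotient at its minimum in the direction of the residual.\<close>
  have key: "0 \<le> 2 * t * (r \<bullet> r) + t\<^sup>2 * (r \<bullet> f r - c * (r \<bullet> r))" for t
  proof -
    have "c * ((v + t *\<^sub>R r) \<bullet> (v + t *\<^sub>R r)) \<le> (v + t *\<^sub>R r) \<bullet> f (v + t *\<^sub>R r)"
      by (intro ray subspace_add subspace_mul V vV rV)
    also have "(v + t *\<^sub>R r) \<bullet> (v + t *\<^sub>R r) = 1 + t\<^sup>2 * (r \<bullet> r)"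
      by (simp add: inner_add_left inner_add_right vv vr inner_commute[of r v] power2_eq_square)
    also have "(v + t *\<^sub>R r) \<bullet> f (v + t *\<^sub>R r) = c + 2 * t * (r \<bullet> r) + t\<^sup>2 * (r \<bullet> f r)"
      using vfr fvr by (simp add: add scale inner_add_left inner_add_right c_def power2_eq_square
          inner_commute[of r "f v"] algebra_simps)
    finally show ?thesis by (simp add: algebra_simps)
  qed
  have "r \<bullet> r = 0"
  proof (rule ccontr)
    assume "r \<bullet> r \<noteq> 0"
    then have pos: "r \<bullet> r > 0" by simp
    define a where "a = r \<bullet> f r - c * (r \<bullet> r)"
    have a: "a \<ge> 0" using ray[OF rV] by (simp add: a_def)
    \<comment> \<open>This t minimizes the quadratic with \<open>1 + a\<close> in place of
      \<open>a\<close>; the added 1 keeps the denominator positive when \<open>a\<close>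
      vanishes.\<close>
    define t where "t = - (r \<bullet> r) / (1 + a)"
    have "0 \<le> 2 * t * (r \<bullet> r) + t\<^sup>2 * a" using key[of t] by (simp add: a_def)
    also have "\<dots> \<le> 2 * t * (r \<bullet> r) + t\<^sup>2 * (1 + a)" by (simp add: algebra_simps)
    also have "\<dots> = - (r \<bullet> r)\<^sup>2 / (1 + a)"
    proof -
      have "t * (1 + a) = - (r \<bullet> r)" using a by (simp add: t_def)
      then have "t\<^sup>2 * (1 + a) = - t * (r \<bullet> r)" by (simp add: power2_eq_square mult.assoc)
      then show ?thesis by (simp add: t_def power2_eq_square)
    qed
    finally show False using pos a by (simp add: divide_simps)
  qed
  then have "f v = c *\<^sub>R v" by (simp add: r_def)
  with vV nv show ?thesis by blast
qed

text \<open>After one unit eigenvector v is split off, self-adjointness makes the orthogonal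
  complement of v in V invariant again. Working with subspaces of a fixed space lets the induction
  on dimension keep the same f.\<close>

lemma self_adjoint_eigenbasis:
  fixes f :: "'a::euclidean_space \<Rightarrow> 'a"
  assumes f: "linear f" and "subspace V" and "f ` V \<subseteq> V"
    and "\<And>x y. x \<in> V \<Longrightarrow> y \<in> V \<Longrightarrow> x \<bullet> f y = f x \<bullet> y"
  shows "\<exists>B. span B = V \<and> pairwise orthogonal B \<and> (\<forall>v\<in>B. norm v = 1 \<and> (\<exists>c. f v = c *\<^sub>R v))"
  using assms(2-)
proof (induction "dim V" arbitrary: V rule: less_induct)
  case less
  show ?case
  proof (cases "V = {0}")
    case True
    then show ?thesis by (intro exI[of _ "{}"]) auto
  next
    case False
    obtain v c where v: "v \<in> V" "norm v = 1" "f v = c *\<^sub>R v"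
      using self_adjoint_eigenvector[OF f less.prems(1,2,3) False] by blast
    have vv: "v \<bullet> v = 1" using v by (simp add: norm_eq_1)
    define W where "W = V \<inter> {x. v \<bullet> x = 0}"
    have W: "subspace W" unfolding W_def
      by (intro subspace_inter less.prems subspace_hyperplane)
    have "v \<notin> W" using vv by (simp add: W_def)
    then have "W \<subset> V" using v(1) unfolding W_def by blast
    then have "dim W < dim V"
      by (metis W dim_psubset less.prems(1) span_eq_iff)
    moreover have "f ` W \<subseteq> W"
      using less.prems(2) less.prems(3)[OF v(1)] v(3) by (auto simp: W_def)
    moreover have "\<And>x y. x \<in> W \<Longrightarrow> y \<in> W \<Longrightarrow> x \<bullet> f y = f x \<bullet> y"
      using less.prems(3) by (auto simp: W_def)
    ultimately obtain B where B: "span B = W" "pairwise orthogonal B"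
        "\<forall>v\<in>B. norm v = 1 \<and> (\<exists>c. f v = c *\<^sub>R v)"
      using less.hyps[of W] W by blast
    have "B \<subseteq> W" using B(1) span_superset by blast
    have "span (insert v B) = V"
    proof
      show "span (insert v B) \<subseteq> V"
        using \<open>B \<subseteq> W\<close> v(1) by (intro span_minimal less.prems) (auto simp: W_def)
      show "V \<subseteq> span (insert v B)"
      proof
        fix x assume "x \<in> V"
        then have "x - (v \<bullet> x) *\<^sub>R v \<in> W"
          using v(1) less.prems(1) vv
          by (auto simp: W_def inner_diff_right intro!: subspace_diff subspace_mul)
        then show "x \<in> span (insert v B)"
          using B(1) by (auto simp: span_breakdown_eq)
      qed
    qed
    moreover have "pairwise orthogonal (insert v B)"
      using B(2) \<open>B \<subseteq> W\<close> by (auto simp: pairwise_insert W_def orthogonal_def inner_commute)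
    ultimately show ?thesis using v B(3) by (intro exI[of _ "insert v B"]) auto
  qed
qed

section \<open>Orthogonal diagonalization of symmetric matrices\<close>

definition diag_mat :: "('n \<Rightarrow> real) \<Rightarrow> real ^ 'n ^ 'n" where
  "diag_mat d = (\<chi> i j. if i = j then d i else 0)"

lemma diag_mat_mult_vec: "(diag_mat d *v x) $ i = d i * x $ i"
  by (simp add: diag_mat_def matrix_vector_mult_def if_distrib[where f="\<lambda>a. a * _"] sum.delta cong: if_cong)

lemma diag_mat_mult: "diag_mat d ** diag_mat e = diag_mat (\<lambda>i. d i * e i)"
  by (auto simp: matrix_eq vec_eq_iff matrix_vector_mul_assoc[symmetric] diag_mat_mult_vec)

lemma diag_mat_one: "diag_mat (\<lambda>i. 1) = mat 1"
  by (simp add: diag_mat_def mat_def)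

lemma transpose_diag_mat: "transpose (diag_mat d) = diag_mat d"
  by (auto simp: diag_mat_def transpose_def vec_eq_iff)

lemma trace_diag_mat: "trace (diag_mat d) = (\<Sum>i\<in>UNIV. d i)"
  by (simp add: trace_def diag_mat_def)

lemma det_diag_mat: "det (diag_mat d) = (\<Prod>i\<in>UNIV. d i)"
  by (subst det_diagonal) (auto simp: diag_mat_def)

lemma inner_matrix_vector_sym:
  fixes A :: "real ^ 'n ^ 'n"
  assumes "A \<in> sym_mats"
  shows "x \<bullet> (A *v y) = (A *v x) \<bullet> y"
proof -
  have "A *v x = x v* A"
    using assms transpose_matrix_vector[of A x] by (simp add: sym_mats_def)
  then show ?thesis by (simp add: dot_lmul_matrix)
qed

lemma spectral_theorem:
  fixes A :: "real ^ 'n ^ 'n"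
  assumes "A \<in> sym_mats"
  obtains Q d where "orthogonal_matrix Q" "A = transpose Q ** diag_mat d ** Q"
proof -
  obtain B where B: "span B = (UNIV :: (real ^ 'n) set)" "pairwise orthogonal B"
      "\<forall>v\<in>B. norm v = 1 \<and> (\<exists>c. A *v v = c *\<^sub>R v)"
    using self_adjoint_eigenbasis[of "\<lambda>x. A *v x" UNIV] inner_matrix_vector_sym[OF assms]
    by auto
  have indep: "independent B"
    using B(2,3) by (intro pairwise_orthogonal_independent) auto
  have "card B = CARD('n)"
    using dim_eq_card[OF _ indep, of UNIV] B(1) by simp
  moreover have "finite B" using indep independent_imp_finite by blast
  ultimately obtain b where b: "bij_betw b (UNIV :: 'n set) B"
    using finite_same_card_bij[of "UNIV :: 'n set" B] by auto
  have bB: "b i \<in> B" for i using b by (auto simp: bij_betw_def)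
  define d where "d i = (SOME c. A *v b i = c *\<^sub>R b i)" for i
  have d: "A *v b i = d i *\<^sub>R b i" for i
    unfolding d_def using B(3) bB by (metis (mono_tags, lifting) someI_ex)
  \<comment> \<open>The eigenvectors are the rows, so \<open>Q *v x\<close> lists the coordinates of
    x in the eigenbasis and \<open>Q\<close> turns A into \<open>diag_mat d\<close>.\<close>
  define Q :: "real ^ 'n ^ 'n" where "Q = (\<chi> i. b i)"
  have binj: "b i = b j \<longleftrightarrow> i = j" for i j using b by (auto simp: bij_betw_def inj_on_def)
  have bb: "b i \<bullet> b j = (if i = j then 1 else 0)" for i j
    using B(2,3) bB[of i] bB[of j] binj[of i j]
    by (auto simp: norm_eq_1 pairwise_def orthogonal_def)
  have Q: "orthogonal_matrix Q"
    using B(3) bB bb by (auto simp: orthogonal_matrix_orthonormal_rows row_def Q_def orthogonal_def)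
  have QQ: "transpose Q ** Q = mat 1" "Q ** transpose Q = mat 1"
    using Q by (auto simp: orthogonal_matrix_def)
  have Qx: "(Q *v x) $ i = b i \<bullet> x" for x i
    by (simp add: Q_def matrix_vector_mul_component)
  have "Q *v (A *v x) = diag_mat d *v (Q *v x)" for x
  proof (subst vec_eq_iff, intro allI)
    fix i
    have "(Q *v (A *v x)) $ i = b i \<bullet> (A *v x)" by (rule Qx)
    also have "\<dots> = d i * (b i \<bullet> x)" by (simp add: inner_matrix_vector_sym[OF assms] d)
    finally show "(Q *v (A *v x)) $ i = (diag_mat d *v (Q *v x)) $ i"
      by (simp add: diag_mat_mult_vec Qx)
  qed
  then have "Q ** A = diag_mat d ** Q"
    by (simp add: matrix_eq matrix_vector_mul_assoc[symmetric])
  then have "transpose Q ** (Q ** A) = transpose Q ** diag_mat d ** Q"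
    by (simp add: matrix_mul_assoc)
  then have "A = transpose Q ** diag_mat d ** Q" by (simp add: matrix_mul_assoc QQ)
  with Q show ?thesis by (rule that)
qed

lemma inner_spectral:
  fixes Q :: "real ^ 'n ^ 'n"
  shows "x \<bullet> ((transpose Q ** diag_mat d ** Q) *v y) = (\<Sum>i\<in>UNIV. d i * (Q *v x) $ i * (Q *v y) $ i)"
proof -
  have "x \<bullet> ((transpose Q ** diag_mat d ** Q) *v y) = x \<bullet> (transpose Q *v (diag_mat d *v (Q *v y)))"
    by (simp only: matrix_vector_mul_assoc matrix_mul_assoc)
  also have "\<dots> = (Q *v x) \<bullet> (diag_mat d *v (Q *v y))"
    by (metis dot_lmul_matrix vector_transpose_matrix)
  also have "\<dots> = (\<Sum>i\<in>UNIV. d i * (Q *v x) $ i * (Q *v y) $ i)"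
    by (simp add: inner_vec_def diag_mat_mult_vec mult_ac)
  finally show ?thesis .
qed

lemma norm_orthogonal_matrix_sum:
  fixes Q :: "real ^ 'n ^ 'n"
  assumes "orthogonal_matrix Q"
  shows "x \<bullet> x = (\<Sum>i\<in>UNIV. ((Q *v x) $ i)\<^sup>2)"
  using inner_spectral[of x Q "\<lambda>i. 1" x] assms
  by (simp add: diag_mat_one orthogonal_matrix_def power2_eq_square)

text \<open>Since the index type is finite, the spectrum is a finite nonempty set, which gives
  \<open>Min\<close> and \<open>Max\<close> in \<open>lambda_min\<close> and
  \<open>lambda_max\<close> their intended meaning.\<close>

lemma eigenvalues_spectral:
  assumes Q: "orthogonal_matrix Q" and A: "A = transpose Q ** diag_mat d ** Q"
  shows "eigenvalues A = range d"
proof -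
  have QQ: "transpose Q ** Q = mat 1" "Q ** transpose Q = mat 1"
    using Q by (auto simp: orthogonal_matrix_def)
  have QA: "Q *v (A *v x) = diag_mat d *v (Q *v x)" for x
    by (metis A QQ(2) matrix_mul_assoc matrix_mul_lid matrix_vector_mul_assoc)
  have inj: "Q *v x = Q *v y \<Longrightarrow> x = y" for x y
    by (metis QQ(1) matrix_vector_mul_assoc matrix_vector_mul_lid)
  show ?thesis
  proof (intro equalityI subsetI)
    fix c assume "c \<in> eigenvalues A"
    then obtain v where v: "v \<noteq> 0" "A *v v = c *\<^sub>R v" by (auto simp: eigenvalues_def)
    then have "Q *v v \<noteq> 0" using inj[of v 0] by auto
    then obtain i where i: "(Q *v v) $ i \<noteq> 0" by (auto simp: vec_eq_iff)
    have "c *\<^sub>R (Q *v v) = diag_mat d *v (Q *v v)"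
      using QA[of v] v by (simp add: matrix_vector_mult_scaleR)
    then have "c * (Q *v v) $ i = d i * (Q *v v) $ i"
      by (metis diag_mat_mult_vec real_scaleR_def vector_scaleR_component)
    with i show "c \<in> range d" by auto
  next
    fix c assume "c \<in> range d"
    then obtain i where c: "c = d i" by auto
    define v where "v = transpose Q *v axis i 1"
    have Qv: "Q *v v = axis i 1"
      unfolding v_def by (metis QQ(2) matrix_vector_mul_assoc matrix_vector_mul_lid)
    have "Q *v (A *v v) = Q *v (d i *\<^sub>R v)"
      unfolding QA matrix_vector_mult_scaleR Qv
      by (auto simp: vec_eq_iff diag_mat_mult_vec axis_def)
    moreover have "v \<noteq> 0" using Qv by (auto simp: axis_eq_0_iff)
    ultimately show "c \<in> eigenvalues A" using c inj by (auto simp: eigenvalues_def)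
  qed
qed

text \<open>In eigen-coordinates the form is a sum of squares weighted by the eigenvalues, so
  eigenvalue bounds become bounds on the quadratic form. These are linear in A, hence stable under
  limits and directly usable in estimates. Positivity of l restores strict definiteness in the
  converse direction.\<close>

lemma pos_def_between_eq:
  assumes "0 < l"
  shows "pos_def_between l u = {A \<in> sym_mats. \<forall>x. l * (x \<bullet> x) \<le> x \<bullet> (A *v x) \<and> x \<bullet> (A *v x) \<le> u * (x \<bullet> x)}"
proof (intro equalityI subsetI)
  fix A assume A: "A \<in> pos_def_between l u"
  then have sym: "A \<in> sym_mats" by (simp add: pos_def_between_def pos_def_mats_def)
  obtain Q d where Q: "orthogonal_matrix Q" and Ad: "A = transpose Q ** diag_mat d ** Q"
    by (rule spectral_theorem[OF sym])
  have "l \<le> d i" "d i \<le> u" for i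
    using A eigenvalues_spectral[OF Q Ad]
    by (auto simp: pos_def_between_def lambda_min_def lambda_max_def)
  then have "l * (x \<bullet> x) \<le> x \<bullet> (A *v x)" "x \<bullet> (A *v x) \<le> u * (x \<bullet> x)" for x
    by (auto simp: Ad inner_spectral norm_orthogonal_matrix_sum[OF Q] sum_distrib_left power2_eq_square mult.assoc
        intro!: sum_mono mult_right_mono)
  then show "A \<in> {A \<in> sym_mats. \<forall>x. l * (x \<bullet> x) \<le> x \<bullet> (A *v x) \<and> x \<bullet> (A *v x) \<le> u * (x \<bullet> x)}"
    using sym by auto
next
  fix A :: "real ^ 'n ^ 'n"
  assume A: "A \<in> {A \<in> sym_mats. \<forall>x. l * (x \<bullet> x) \<le> x \<bullet> (A *v x) \<and> x \<bullet> (A *v x) \<le> u * (x \<bullet> x)}"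
  then have sym: "A \<in> sym_mats" by simp
  obtain Q d where Q: "orthogonal_matrix Q" and Ad: "A = transpose Q ** diag_mat d ** Q"
    by (rule spectral_theorem[OF sym])
  have ev: "l \<le> c \<and> c \<le> u" if c: "c \<in> eigenvalues A" for c
  proof -
    obtain v where v: "v \<noteq> 0" "A *v v = c *\<^sub>R v" using c by (auto simp: eigenvalues_def)
    then have "l * (v \<bullet> v) \<le> c * (v \<bullet> v)" "c * (v \<bullet> v) \<le> u * (v \<bullet> v)" using A by (auto dest: spec[of _ v])
    then show ?thesis using v by simp
  qed
  have "0 < x \<bullet> (A *v x)" if "x \<noteq> 0" for x
    using A that assms by (smt (verit) inner_gt_zero_iff mem_Collect_eq mult_pos_pos)
  then show "A \<in> pos_def_between l u"
    using ev sym eigenvalues_spectral[OF Q Ad]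
    by (auto simp: pos_def_between_def lambda_min_def lambda_max_def pos_def_mats_def)
qed

text \<open>The uniform bound l keeps limits away from the boundary of the positive definite cone,
  which is not closed itself. The limit of a trajectory that stays inside is thus still
  invertible.\<close>

lemma closed_pos_def_between:
  assumes "0 < l"
  shows "closed (pos_def_between l u :: (real ^ 'n ^ 'n) set)"
proof -
  have "continuous_on UNIV (\<lambda>A :: real ^ 'n ^ 'n. A *v x)" for x
    unfolding matrix_vector_mult_def by (intro continuous_intros)
  moreover have "continuous_on UNIV (\<lambda>A :: real ^ 'n ^ 'n. transpose A)"
    unfolding transpose_def by (intro continuous_intros)
  ultimately show ?thesis
    unfolding pos_def_between_eq[OF assms] sym_mats_def mem_Collect_eq
    by (intro closed_Collect_conj closed_Collect_all closed_Collect_eq closed_Collect_le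
        continuous_intros)
qed

section \<open>Positive definite matrices: inverse and strict concavity of
  \<open>ln det\<close>\<close>

lemma spectral_pos_def:
  assumes "A \<in> pos_def_mats"
  obtains Q d where "orthogonal_matrix Q" "A = transpose Q ** diag_mat d ** Q"
    "\<And>i. 0 < d i" "det A = (\<Prod>i\<in>UNIV. d i)"
proof -
  have sym: "A \<in> sym_mats" using assms by (simp add: pos_def_mats_def)
  obtain Q d where Q: "orthogonal_matrix Q" and Ad: "A = transpose Q ** diag_mat d ** Q"
    by (rule spectral_theorem[OF sym])
  have "0 < d i" for i
  proof -
    have "d i \<in> eigenvalues A" using eigenvalues_spectral[OF Q Ad] by simp
    then obtain v where "v \<noteq> 0" "A *v v = d i *\<^sub>R v" by (auto simp: eigenvalues_def)
    moreover from this have "0 < v \<bullet> (A *v v)" using assms unfolding pos_def_mats_def by blast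
    ultimately show ?thesis using inner_ge_zero[of v] by (auto simp: zero_less_mult_iff)
  qed
  moreover have "(det Q)\<^sup>2 = 1" using det_orthogonal_matrix[OF Q] by auto
  then have "det A = (\<Prod>i\<in>UNIV. d i)"
    by (simp add: Ad det_mul det_diag_mat power2_eq_square)
  ultimately show ?thesis using that Q Ad by blast
qed

lemma pos_def_det_pos: "A \<in> pos_def_mats \<Longrightarrow> 0 < det A"
  by (erule spectral_pos_def) (simp add: prod_pos)

lemma matrix_inv_pos_def:
  assumes "A \<in> pos_def_mats"
  shows "matrix_inv A ** A = mat 1" "A ** matrix_inv A = mat 1"
    and "A *v (matrix_inv A *v x) = x" and "matrix_inv (matrix_inv A) = A"
proof -
  have "invertible A" using pos_def_det_pos[OF assms] by (simp add: invertible_det_nz)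
  then have "A ** matrix_inv A = mat 1 \<and> matrix_inv A ** A = mat 1"
    unfolding invertible_def matrix_inv_def by (rule someI_ex)
  then show 1: "matrix_inv A ** A = mat 1" and 2: "A ** matrix_inv A = mat 1" by auto
  then show "A *v (matrix_inv A *v x) = x"
    by (simp add: matrix_vector_mul_assoc)
  have "\<exists>B. matrix_inv A ** B = mat 1 \<and> B ** matrix_inv A = mat 1" using 1 2 by blast
  then have "matrix_inv A ** matrix_inv (matrix_inv A) = mat 1"
    unfolding matrix_inv_def[of "matrix_inv A"] by (rule someI2_ex) simp
  then show "matrix_inv (matrix_inv A) = A"
    using 2 by (metis matrix_mul_assoc matrix_mul_lid matrix_mul_rid)
qed

text \<open>Sum \<open>ln x \<le> x - 1\<close> over the eigenvalues; the inequality is strict at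
  any eigenvalue other than 1, and one exists because C is not the identity.\<close>

lemma ln_det_le_trace:
  assumes C: "C \<in> pos_def_mats" and ne: "C \<noteq> mat 1"
  shows "ln (det C) < trace (C - mat 1)"
proof -
  obtain Q d where Q: "orthogonal_matrix Q" and Cd: "C = transpose Q ** diag_mat d ** Q"
    and d: "\<And>i. 0 < d i" and "det C = (\<Prod>i\<in>UNIV. d i)"
    by (rule spectral_pos_def[OF C]) blast
  then have det: "ln (det C) = (\<Sum>i\<in>UNIV. ln (d i))"
    using d by (simp add: ln_prod less_imp_neq[THEN not_sym])
  have QQ: "transpose Q ** Q = mat 1" "Q ** transpose Q = mat 1"
    using Q by (auto simp: orthogonal_matrix_def)
  have "trace C = trace (Q ** (transpose Q ** diag_mat d))"
    unfolding Cd by (rule trace_mul_sym)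
  then have tr: "trace (C - mat 1) = (\<Sum>i\<in>UNIV. d i - 1)"
    by (simp add: matrix_mul_assoc QQ trace_diag_mat trace_sub trace_I sum_subtractf)
  have "\<exists>i. d i \<noteq> 1"
  proof (rule ccontr)
    assume "\<not> ?thesis"
    then have "d = (\<lambda>i. 1)" by auto
    with ne show False by (simp add: Cd diag_mat_one QQ)
  qed
  then obtain i where i: "d i \<noteq> 1" by auto
  then have "ln (d i) < d i - 1"
    using ln_le_minus_one[OF d, of i] ln_eq_minus_one[OF d, of i] by linarith
  moreover have "ln (d j) \<le> d j - 1" for j using ln_le_minus_one[OF d] .
  ultimately show ?thesis unfolding det tr by (intro sum_strict_mono_ex1) auto
qed

text \<open>Conjugation by the inverse square root R of A moves the base point to the identity,
  where the previous lemma applies. The symmetric form \<open>R ** U ** R\<close> is used because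
  the product of the inverse of A with U need not be symmetric; determinant and trace do not see the
  difference.\<close>

lemma ln_det_strict_concave:
  assumes A: "A \<in> pos_def_mats" and U: "U \<in> pos_def_mats" and ne: "U \<noteq> A"
  shows "ln (det U) < ln (det A) + trace (matrix_inv A ** (U - A))"
proof -
  obtain Q d where Q: "orthogonal_matrix Q" and Ad: "A = transpose Q ** diag_mat d ** Q"
    and d: "\<And>i. 0 < d i"
    by (rule spectral_pos_def[OF A]) blast
  have QQ: "transpose Q ** Q = mat 1" "Q ** transpose Q = mat 1"
    using Q by (auto simp: orthogonal_matrix_def)
  define R where "R = transpose Q ** diag_mat (\<lambda>i. 1 / sqrt (d i)) ** Q"
  have symR: "transpose R = R"
    by (simp add: R_def matrix_transpose_mul transpose_diag_mat matrix_mul_assoc)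
  have conj: "(transpose Q ** diag_mat a ** Q) ** (transpose Q ** diag_mat b ** Q)
      = transpose Q ** diag_mat (\<lambda>i. a i * b i) ** Q" for a b
  proof -
    have "(transpose Q ** diag_mat a ** Q) ** (transpose Q ** diag_mat b ** Q)
      = transpose Q ** diag_mat a ** (Q ** transpose Q) ** diag_mat b ** Q"
      by (simp only: matrix_mul_assoc)
    also have "\<dots> = transpose Q ** (diag_mat a ** diag_mat b) ** Q"
      by (simp only: QQ matrix_mul_rid) (simp only: matrix_mul_assoc)
    finally show ?thesis by (simp only: diag_mat_mult)
  qed
  have sq: "1 / sqrt (d i) * d i * (1 / sqrt (d i)) = 1" for i
    using d[of i] by (simp add: field_simps flip: power2_eq_square)
  have RAR: "R ** A ** R = mat 1"
    unfolding R_def Ad conj by (simp only: sq diag_mat_one) (simp add: QQ)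
  then have RA: "R ** (A ** R) = mat 1" by (simp add: matrix_mul_assoc)
  then have ARR: "A ** R ** R = mat 1" by (simp add: matrix_left_right_inverse)
  have RR: "R ** R = matrix_inv A"
    using ARR matrix_inv_pos_def(1)[OF A] by (metis matrix_mul_assoc matrix_mul_lid matrix_mul_rid)
  define C where "C = R ** U ** R"
  have Rinj: "R *v x = 0 \<Longrightarrow> x = 0" for x
    by (metis ARR matrix_vector_mul_assoc matrix_vector_mul_lid matrix_vector_mult_0_right)
  have symU: "transpose U = U" using U by (simp add: pos_def_mats_def sym_mats_def)
  have "C \<in> pos_def_mats"
  proof -
    have "transpose C = C" by (simp add: C_def matrix_transpose_mul symR symU matrix_mul_assoc)
    moreover have "0 < x \<bullet> (C *v x)" if "x \<noteq> 0" for x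
    proof -
      have "x \<bullet> (C *v x) = (R *v x) \<bullet> (U *v (R *v x))"
        using inner_matrix_vector_sym[of R x] symR
        by (simp add: C_def sym_mats_def matrix_vector_mul_assoc[symmetric])
      then show ?thesis using Rinj that U by (auto simp: pos_def_mats_def)
    qed
    ultimately show ?thesis by (simp add: pos_def_mats_def sym_mats_def)
  qed
  moreover have "C \<noteq> mat 1"
  proof
    assume "C = mat 1"
    then have "R ** U ** R = R ** A ** R" using RAR by (simp add: C_def)
    \<comment> \<open>\<open>A ** R\<close> is a left inverse and \<open>R ** A\<close> a right
      inverse of R, so these factors undo the conjugation and leave \<open>U = A\<close>.\<close>
    then have "(A ** R) ** (R ** U ** R) ** (R ** A) = (A ** R) ** (R ** A ** R) ** (R ** A)" by simp
    then have "(A ** R ** R) ** U ** (R ** R ** A) = (A ** R ** R) ** A ** (R ** R ** A)"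
      by (simp only: matrix_mul_assoc)
    moreover have "R ** R ** A = mat 1" using RR matrix_inv_pos_def[OF A] by simp
    ultimately show False using ARR ne by simp
  qed
  ultimately have "ln (det C) < trace (C - mat 1)" by (rule ln_det_le_trace)
  moreover have "det C = det U / det A"
  proof -
    have "det R * det A * det R = 1" using RAR by (metis det_I det_mul)
    then show ?thesis using pos_def_det_pos[OF A]
      by (simp add: C_def det_mul field_simps)
  qed
  moreover have "trace (C - mat 1) = trace (matrix_inv A ** (U - A))"
  proof -
    have "trace C = trace (R ** (R ** U))"
      unfolding C_def by (rule trace_mul_sym)
    then have "trace C = trace (matrix_inv A ** U)" by (simp add: matrix_mul_assoc RR)
    moreover have "matrix_inv A ** (U - A) = matrix_inv A ** U - matrix_inv A ** A"
      by (simp add: matrix_matrix_mult_def vec_eq_iff sum_subtractf right_diff_distrib)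
    ultimately show ?thesis
      by (simp add: trace_sub matrix_inv_pos_def[OF A])
  qed
  ultimately show ?thesis using pos_def_det_pos[OF A] pos_def_det_pos[OF U] by (simp add: ln_div)
qed

text \<open>The form of \<open>X n\<close> is bounded below with the common constant l, so
  \<open>l * norm w \<le> norm (X n *v w)\<close>. Taking for w the difference of the two solutions,
  \<open>X n *v w\<close> is the residual of the limiting solution in the n-th equation, and this
  tends to 0.\<close>

lemma continuous_on_matrix_inv_mult:
  fixes u :: "real ^ 'n"
  assumes l: "0 < l"
  shows "continuous_on (pos_def_between l \<psi>) (\<lambda>A. matrix_inv A *v u)"
proof (subst continuous_on_sequentially, intro ballI allI impI)
  fix X :: "nat \<Rightarrow> real ^ 'n ^ 'n" and A
  assume A: "A \<in> pos_def_between l \<psi>" and X: "(\<forall>n. X n \<in> pos_def_between l \<psi>) \<and> X \<longlonglongrightarrow> A"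
  define x where "x = matrix_inv A *v u"
  have PD: "A \<in> pos_def_mats" "X n \<in> pos_def_mats" for n
    using A X by (auto simp: pos_def_between_def)
  have bound: "norm (matrix_inv (X n) *v u - x) \<le> norm (u - X n *v x) / l" for n
  proof -
    define w where "w = matrix_inv (X n) *v u - x"
    have Xw: "X n *v w = u - X n *v x"
      by (simp add: w_def matrix_vector_mult_diff_distrib matrix_inv_pos_def[OF PD(2)])
    have "l * (norm w)\<^sup>2 \<le> w \<bullet> (X n *v w)"
      using X by (auto simp: pos_def_between_eq[OF l] power2_norm_eq_inner)
    also have "\<dots> \<le> norm w * norm (u - X n *v x)"
      unfolding Xw by (rule norm_cauchy_schwarz)
    finally have "norm w * (l * norm w) \<le> norm w * norm (u - X n *v x)"
      by (simp add: power2_eq_square mult_ac)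
    then have "l * norm w \<le> norm (u - X n *v x)"
      by (cases "w = 0") (auto simp: mult_le_cancel_left)
    then show ?thesis using l by (simp add: w_def field_simps)
  qed
  have "continuous_on UNIV (\<lambda>A :: real ^ 'n ^ 'n. A *v x)"
    unfolding matrix_vector_mult_def by (intro continuous_intros)
  then have "(\<lambda>n. X n *v x) \<longlonglongrightarrow> A *v x"
    using X by (auto intro: continuous_on_tendsto_compose[where s=UNIV])
  moreover have "A *v x = u" by (simp add: x_def matrix_inv_pos_def[OF PD(1)])
  ultimately have "(\<lambda>n. norm (u - X n *v x) / l) \<longlonglongrightarrow> norm (u - u) / l"
    using l by (intro tendsto_intros) auto
  then have lim: "(\<lambda>n. norm (u - X n *v x) / l) \<longlonglongrightarrow> 0" by simp
  have "(\<lambda>n. matrix_inv (X n) *v u - x) \<longlonglongrightarrow> 0"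
    by (rule Lim_null_comparison[OF always_eventually lim]) (rule allI, rule bound)
  then show "((\<lambda>A. matrix_inv A *v u) \<circ> X) \<longlonglongrightarrow> matrix_inv A *v u"
    by (simp add: LIM_zero_iff x_def comp_def)
qed

section \<open>Moments from a Gaussian moment generating function\<close>

text \<open>For nonnegative z the left side is \<open>exp z * (1 - exp (- z))\<^sup>2\<close>, and
  \<open>1 - exp (- z) \<le> z\<close>. This provides the integrable majorant for the difference
  quotients below.\<close>

lemma second_difference_exp_le: "exp z + exp (- z) - 2 \<le> z\<^sup>2 * exp \<bar>z\<bar>" for z :: real
proof -
  have *: "exp w + exp (- w) - 2 \<le> w\<^sup>2 * exp w" if "0 \<le> w" for w :: real
  proof -
    have "1 - exp (- w) \<le> w" using exp_ge_add_one_self[of "- w"] by simp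
    moreover have "0 \<le> 1 - exp (- w)" using that by simp
    ultimately have "(1 - exp (- w))\<^sup>2 \<le> w\<^sup>2" by (intro power_mono)
    then have "exp w * (1 - exp (- w))\<^sup>2 \<le> exp w * w\<^sup>2" by (intro mult_left_mono) auto
    moreover have "exp w * (1 - exp (- w))\<^sup>2 = exp w + exp (- w) - 2"
      by (simp add: power2_eq_square algebra_simps flip: exp_add)
    ultimately show ?thesis by (simp add: mult.commute)
  qed
  show ?thesis using *[of z] *[of "- z"] by (cases "0 \<le> z") (auto simp: algebra_simps)
qed

lemma exp_abs_le: "exp \<bar>y\<bar> \<le> exp y + exp (- y)" for y :: real
  by (cases "0 \<le> y") auto

text \<open>The second moment is the second derivative of the moment generating function at 0.
  Symmetric second difference quotients are used: their odd terms cancel, so the first moment never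
  has to be computed, and dominated convergence exchanges limit and integral.\<close>

lemma gaussian_mgf_moments:
  fixes Y :: "'a \<Rightarrow> real"
  assumes "prob_space \<nu>" and [measurable]: "Y \<in> borel_measurable \<nu>"
    and mgf: "\<And>t. (\<integral>\<^sup>+x. ennreal (exp (t * Y x)) \<partial>\<nu>) = ennreal (exp (t\<^sup>2 * s / 2))"
  shows "(\<integral>\<^sup>+x. ennreal ((Y x)\<^sup>2) \<partial>\<nu>) = ennreal s"
    and "(\<integral>\<^sup>+x. ennreal ((Y x) ^ 4) \<partial>\<nu>) \<le> ennreal (512 * exp (s / 2))"
proof -
  interpret prob_space \<nu> by (rule assms(1))
  have hbi: "has_bochner_integral \<nu> (\<lambda>x. exp (t * Y x)) (exp (t\<^sup>2 * s / 2))" for t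
    by (rule has_bochner_integral_nn_integral) (auto simp: mgf)
  then have int: "integrable \<nu> (\<lambda>x. exp (t * Y x))"
    and val: "(\<integral>x. exp (t * Y x) \<partial>\<nu>) = exp (t\<^sup>2 * s / 2)" for t
    by (auto simp: has_bochner_integral_iff)
  define t :: "nat \<Rightarrow> real" where "t n = 1 / (real n + 1)" for n
  define g where "g n x = (exp (t n * Y x) + exp (- t n * Y x) - 2) / (t n)\<^sup>2" for n x
  have [measurable]: "g n \<in> borel_measurable \<nu>" for n unfolding g_def by measurable
  have g_int: "(\<integral>x. g n x \<partial>\<nu>) = (2 * exp ((t n)\<^sup>2 * s / 2) - 2) / (t n)\<^sup>2" for n
    using int[of "t n"] int[of "- t n"] val[of "t n"] val[of "- t n"]
    by (simp add: g_def prob_space)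
  have bound: "norm (g n x) \<le> 4 * (exp (2 * Y x) + exp (- 2 * Y x))" for n x
  proof -
    let ?y = "Y x"
    have t: "0 < t n" "t n \<le> 1" by (auto simp: t_def)
    have "0 \<le> exp (t n * ?y) + exp (- (t n * ?y)) - 2"
      using exp_ge_add_one_self[of "t n * ?y"] exp_ge_add_one_self[of "- (t n * ?y)"] by linarith
    then have "norm (g n x) = (exp (t n * ?y) + exp (- (t n * ?y)) - 2) / (t n)\<^sup>2"
      by (simp add: g_def)
    also have "\<dots> \<le> (t n * ?y)\<^sup>2 * exp \<bar>t n * ?y\<bar> / (t n)\<^sup>2"
      by (intro divide_right_mono second_difference_exp_le) auto
    also have "\<dots> = ?y\<^sup>2 * exp (t n * \<bar>?y\<bar>)"
      using t by (simp add: power_mult_distrib abs_mult)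
    also have "\<dots> \<le> ?y\<^sup>2 * exp \<bar>?y\<bar>"
      using t by (intro mult_left_mono) (auto intro: mult_left_le_one_le)
    also have "?y\<^sup>2 \<le> 4 * exp \<bar>?y\<bar>"
    proof -
      have "\<bar>?y\<bar> / 2 \<le> exp (\<bar>?y\<bar> / 2)" using exp_ge_add_one_self[of "\<bar>?y\<bar> / 2"] by linarith
      then have "(\<bar>?y\<bar> / 2)\<^sup>2 \<le> (exp (\<bar>?y\<bar> / 2))\<^sup>2" by (intro power_mono) auto
      then show ?thesis by (simp add: power_divide flip: exp_double)
    qed
    also have "4 * exp \<bar>?y\<bar> * exp \<bar>?y\<bar> = 4 * exp \<bar>2 * ?y\<bar>" by (simp add: abs_mult flip: exp_add)
    also have "\<dots> \<le> 4 * (exp (2 * ?y) + exp (- 2 * ?y))" using exp_abs_le[of "2 * ?y"] by simp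
    finally show ?thesis by (simp add: mult_right_mono)
  qed
  have dom: "integrable \<nu> (\<lambda>x. 4 * (exp (2 * Y x) + exp (- 2 * Y x)))"
    using int[of 2] int[of "- 2"] by simp
  have lim: "(\<lambda>n. g n x) \<longlonglongrightarrow> (Y x)\<^sup>2" for x
  proof -
    have "(\<lambda>n. (exp (1 / (real n + 1) * y) + exp (- (1 / (real n + 1)) * y) - 2) / (1 / (real n + 1))\<^sup>2)
        \<longlonglongrightarrow> y\<^sup>2" for y :: real
      unfolding power2_eq_square[of y] by real_asymp
    then show ?thesis by (simp add: g_def t_def)
  qed
  have Y2: "integrable \<nu> (\<lambda>x. (Y x)\<^sup>2)" and "(\<lambda>n. \<integral>x. g n x \<partial>\<nu>) \<longlonglongrightarrow> (\<integral>x. (Y x)\<^sup>2 \<partial>\<nu>)"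
    using integrable_dominated_convergence[OF _ _ dom AE_I2[OF lim] AE_I2[OF bound]]
      integral_dominated_convergence[OF _ _ dom AE_I2[OF lim] AE_I2[OF bound]] by simp_all
  moreover have "(\<lambda>n. (2 * exp ((1 / (real n + 1))\<^sup>2 * s / 2) - 2) / (1 / (real n + 1))\<^sup>2) \<longlonglongrightarrow> s"
    by real_asymp
  ultimately have "(\<integral>x. (Y x)\<^sup>2 \<partial>\<nu>) = s"
    unfolding g_int t_def by (blast intro: LIMSEQ_unique)
  with Y2 show "(\<integral>\<^sup>+x. ennreal ((Y x)\<^sup>2) \<partial>\<nu>) = ennreal s"
    by (simp add: nn_integral_eq_integral)
  \<comment> \<open>From \<open>y / 4 \<le> exp (y / 4)\<close> raised to the fourth power: 256 is
    \<open>4 ^ 4\<close>. Each of the two exponentials has integral \<open>exp (s / 2)\<close>,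
    whence 512 in the bound.\<close>
  have "(Y x) ^ 4 \<le> 256 * (exp (1 * Y x) + exp (- 1 * Y x))" for x
  proof -
    have "\<bar>Y x\<bar> / 4 \<le> exp (\<bar>Y x\<bar> / 4)" using exp_ge_add_one_self[of "\<bar>Y x\<bar> / 4"] by linarith
    then have "(\<bar>Y x\<bar> / 4) ^ 4 \<le> exp (\<bar>Y x\<bar> / 4) ^ 4" by (intro power_mono) auto
    also have "\<dots> = exp \<bar>Y x\<bar>" by (simp flip: exp_of_nat_mult)
    finally show ?thesis using exp_abs_le[of "Y x"] by (simp add: power_divide)
  qed
  then have "(\<integral>\<^sup>+x. ennreal ((Y x) ^ 4) \<partial>\<nu>) \<le> (\<integral>\<^sup>+x. ennreal (256 * (exp (1 * Y x) + exp (- 1 * Y x))) \<partial>\<nu>)"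
    by (intro nn_integral_mono ennreal_leI)
  also have "\<dots> = ennreal (256 * (exp (s / 2) + exp (s / 2)))"
    using int[of 1] int[of "-1"] val[of 1] val[of "-1"] by (subst nn_integral_eq_integral) auto
  finally show "(\<integral>\<^sup>+x. ennreal ((Y x) ^ 4) \<partial>\<nu>) \<le> ennreal (512 * exp (s / 2))" by simp
qed

section \<open>Square-integrable martingale differences\<close>

context prob_space begin

lemma integrable_mult_of_squares:
  fixes f g :: "'a \<Rightarrow> real"
  assumes [measurable]: "f \<in> borel_measurable M" "g \<in> borel_measurable M"
    and "integrable M (\<lambda>x. (f x)\<^sup>2)" "integrable M (\<lambda>x. (g x)\<^sup>2)"
  shows "integrable M (\<lambda>x. f x * g x)"
proof (rule Bochner_Integration.integrable_bound)
  show "integrable M (\<lambda>x. (f x)\<^sup>2 + (g x)\<^sup>2)" using assms by simp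
  have "\<bar>a * b\<bar> \<le> a\<^sup>2 + b\<^sup>2" for a b :: real
  proof -
    have "2 * (\<bar>a\<bar> * \<bar>b\<bar>) \<le> a\<^sup>2 + b\<^sup>2"
      using sum_squares_bound[of "\<bar>a\<bar>" "\<bar>b\<bar>"] by (simp add: mult.assoc)
    moreover have "0 \<le> \<bar>a\<bar> * \<bar>b\<bar>" by simp
    ultimately show ?thesis unfolding abs_mult by linarith
  qed
  then show "AE x in M. norm (f x * g x) \<le> norm ((f x)\<^sup>2 + (g x)\<^sup>2)" by simp
qed simp

text \<open>Kolmogorov's inequality. The stopped sum is frozen at the first value of size at least
  \<epsilon>, so the maximal event is contained in the event that the stopped sum is large at time
  n. Orthogonality of the increments bounds its second moment, and Markov's inequality
  finishes.\<close>

lemma martingale_maximal_inequality: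
  fixes X :: "nat \<Rightarrow> 'a \<Rightarrow> real" and F :: "nat \<Rightarrow> 'a measure"
  assumes sub: "\<And>k. subalgebra M (F k)"
    and mono: "\<And>j k. j \<le> k \<Longrightarrow> sets (F j) \<subseteq> sets (F k)"
    and X: "\<And>k. X k \<in> borel_measurable (F (Suc k))"
    and X2: "\<And>k. integrable M (\<lambda>x. (X k x)\<^sup>2)"
    and X0: "\<And>k. AE x in M. real_cond_exp M (F k) (X k) x = 0"
    and \<epsilon>: "0 < \<epsilon>"
  shows "prob {x \<in> space M. \<exists>j\<le>n. \<epsilon> \<le> \<bar>\<Sum>k<j. X k x\<bar>} \<le> (\<Sum>k<n. expectation (\<lambda>x. (X k x)\<^sup>2)) / \<epsilon>\<^sup>2"
proof -
  have sp: "space (F k) = space M" for k using sub[of k] by (simp add: subalgebra_def)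
  have XF: "X j \<in> borel_measurable (F k)" if "j < k" for j k
  proof (rule measurable_from_subalg[OF _ X])
    show "subalgebra (F k) (F (Suc j))"
      using mono[of "Suc j" k] that by (simp add: subalgebra_def sp Suc_le_eq)
  qed
  have XM[measurable]: "X k \<in> borel_measurable M" for k
    by (rule measurable_from_subalg[OF sub X])
  \<comment> \<open>\<open>P k\<close> involves only \<open>X 0\<close> up to
    \<open>X (k - 1)\<close>, hence is decided by \<open>F k\<close>, while \<open>X k\<close> is
    revealed in \<open>F (Suc k)\<close>. Whether to add the next increment is thus known before it
    is drawn.\<close>
  define P where "P k x \<longleftrightarrow> (\<forall>j\<le>k. \<bar>\<Sum>i<j. X i x\<bar> < \<epsilon>)" for k x
  \<comment> \<open>\<open>T\<close> is the martingale stopped when it first leaves \<open>(-\<epsilon>, \<epsilon>)\<close>.\<close>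
  define Y where "Y k x = (if P k x then X k x else 0)" for k x
  define T where "T k x = (\<Sum>i<k. Y i x)" for k x
  have SF: "(\<lambda>x. \<Sum>i<j. X i x) \<in> borel_measurable (F k)" if "j \<le> k" for j k
    using that by (intro borel_measurable_sum XF) auto
  have PF: "Measurable.pred (F k) (P j)" if "j \<le> k" for j k
  proof -
    note SF[measurable]
    have "Measurable.pred (F k) (\<lambda>x. \<forall>i\<in>{..j}. \<bar>\<Sum>l<i. X l x\<bar> < \<epsilon>)"
      using that by (intro pred_intros_finite) auto
    moreover have "P j = (\<lambda>x. \<forall>i\<in>{..j}. \<bar>\<Sum>l<i. X l x\<bar> < \<epsilon>)"
      by (auto simp: P_def fun_eq_iff)
    ultimately show ?thesis by simp
  qed
  have YF: "Y j \<in> borel_measurable (F k)" if "j < k" for j k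
    unfolding Y_def using that
    by (intro measurable_If XF PF[unfolded pred_def]) auto
  have TF: "T k \<in> borel_measurable (F k)" for k
    unfolding T_def by (intro borel_measurable_sum YF) auto
  have YM[measurable]: "Y k \<in> borel_measurable M" for k
    by (rule measurable_from_subalg[OF sub YF]) auto
  have TM[measurable]: "T k \<in> borel_measurable M" for k
    by (rule measurable_from_subalg[OF sub TF])
  have Y2: "integrable M (\<lambda>x. (Y k x)\<^sup>2)" for k
  proof (rule Bochner_Integration.integrable_bound[OF X2[of k]])
    show "AE x in M. norm ((Y k x)\<^sup>2) \<le> norm ((X k x)\<^sup>2)" by (simp add: Y_def)
  qed simp
  have Tsq: "integrable M (\<lambda>x. (T k x)\<^sup>2) \<and>
      expectation (\<lambda>x. (T k x)\<^sup>2) \<le> (\<Sum>i<k. expectation (\<lambda>x. (X i x)\<^sup>2))" for k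
  proof (induction k)
    case (Suc k)
    \<comment> \<open>The cross term of \<open>T k\<close> and \<open>Y k\<close> equals
      \<open>f * X k\<close>: moving the cut-off onto \<open>T k\<close> leaves an
      \<open>F k\<close>-measurable factor times an increment of conditional mean 0.\<close>
    define f where "f x = (if P k x then T k x else 0)" for x
    have fF: "f \<in> borel_measurable (F k)"
      unfolding f_def by (intro measurable_If TF PF[unfolded pred_def]) auto
    have fM[measurable]: "f \<in> borel_measurable M" by (rule measurable_from_subalg[OF sub fF])
    have f2: "integrable M (\<lambda>x. (f x)\<^sup>2)"
    proof (rule Bochner_Integration.integrable_bound[OF conjunct1[OF Suc]])
      show "AE x in M. norm ((f x)\<^sup>2) \<le> norm ((T k x)\<^sup>2)" by (simp add: f_def)
    qed simp
    have fX: "integrable M (\<lambda>x. f x * X k x)"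
      by (intro integrable_mult_of_squares f2 X2 fM XM)
    interpret finite_measure_subalgebra M "F k"
      by unfold_locales (rule sub)
    have "expectation (\<lambda>x. f x * X k x) = expectation (\<lambda>x. f x * real_cond_exp M (F k) (X k) x)"
      by (rule real_cond_exp_intg(2)[symmetric]) (intro fX fF XM)+
    also have "\<dots> = expectation (\<lambda>x. 0)"
      using X0[of k] by (intro integral_cong_AE) (auto intro: borel_measurable_cond_exp2)
    finally have orth: "expectation (\<lambda>x. f x * X k x) = 0" by simp
    have eq: "(T (Suc k) x)\<^sup>2 = (T k x)\<^sup>2 + 2 * (f x * X k x) + (Y k x)\<^sup>2" for x
      by (simp add: T_def f_def Y_def power2_eq_square algebra_simps)
    have "expectation (\<lambda>x. (Y k x)\<^sup>2) \<le> expectation (\<lambda>x. (X k x)\<^sup>2)"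
      by (intro integral_mono Y2 X2) (auto simp: Y_def)
    then show ?case
      using Suc fX Y2[of k] orth unfolding eq by simp
  qed (simp add: T_def)
  have hit: "\<epsilon> \<le> \<bar>T n x\<bar>" if "\<exists>j\<le>n. \<epsilon> \<le> \<bar>\<Sum>k<j. X k x\<bar>" for x
  proof -
    define j where "j = (LEAST j. \<epsilon> \<le> \<bar>\<Sum>k<j. X k x\<bar>)"
    from that obtain j0 where j0: "j0 \<le> n" "\<epsilon> \<le> \<bar>\<Sum>k<j0. X k x\<bar>" by blast
    have j: "\<epsilon> \<le> \<bar>\<Sum>k<j. X k x\<bar>" unfolding j_def by (rule LeastI[of _ j0]) (rule j0)
    have "j \<le> n" unfolding j_def using j0 by (meson Least_le order_trans)
    have P: "P k x \<longleftrightarrow> k < j" for k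
    proof
      assume "P k x" then show "k < j" using j by (auto simp: P_def not_less[symmetric])
    next
      assume "k < j" then show "P k x"
        unfolding P_def j_def by (metis le_less_trans not_le_imp_less not_less_Least)
    qed
    have "T n x = (\<Sum>i\<in>{..<n}. if i < j then X i x else 0)" by (simp add: T_def Y_def P)
    also have "\<dots> = (\<Sum>i\<in>{..<n} \<inter> {i. i < j}. X i x)" by (simp add: sum.inter_restrict)
    also have "{..<n} \<inter> {i. i < j} = {..<j}" using \<open>j \<le> n\<close> by auto
    finally show ?thesis using j by simp
  qed
  have "prob {x \<in> space M. \<exists>j\<le>n. \<epsilon> \<le> \<bar>\<Sum>k<j. X k x\<bar>} \<le> prob {x \<in> space M. \<epsilon>\<^sup>2 \<le> (T n x)\<^sup>2}"
    using hit \<epsilon> by (intro finite_measure_mono) (auto simp: abs_le_square_iff[symmetric])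
  also have "\<dots> \<le> expectation (\<lambda>x. (T n x)\<^sup>2) / \<epsilon>\<^sup>2"
    using integral_Markov_inequality_measure[OF conjunct1[OF Tsq[of n]], of "{}" "\<epsilon>\<^sup>2"] \<epsilon> by simp
  also have "\<dots> \<le> (\<Sum>k<n. expectation (\<lambda>x. (X k x)\<^sup>2)) / \<epsilon>\<^sup>2"
    using Tsq[of n] \<epsilon> by (intro divide_right_mono) auto
  finally show ?thesis .
qed

text \<open>Started at time m, the maximal inequality bounds the probability that the partial sums
  ever move by \<epsilon> by a tail of the variance series, which vanishes as m grows. Almost surely
  some m therefore confines all later motion, for every \<epsilon> of the form
  \<open>1 / real (Suc i)\<close>, and this is the Cauchy criterion.\<close>

lemma martingale_differences_summable:
  fixes X :: "nat \<Rightarrow> 'a \<Rightarrow> real" and F :: "nat \<Rightarrow> 'a measure"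
  assumes sub: "\<And>k. subalgebra M (F k)"
    and mono: "\<And>j k. j \<le> k \<Longrightarrow> sets (F j) \<subseteq> sets (F k)"
    and X: "\<And>k. X k \<in> borel_measurable (F (Suc k))"
    and X2: "\<And>k. integrable M (\<lambda>x. (X k x)\<^sup>2)"
    and X0: "\<And>k. AE x in M. real_cond_exp M (F k) (X k) x = 0"
    and sm: "summable (\<lambda>k. expectation (\<lambda>x. (X k x)\<^sup>2))"
  shows "AE x in M. summable (\<lambda>k. X k x)"
proof -
  have XM[measurable]: "X k \<in> borel_measurable M" for k
    by (rule measurable_from_subalg[OF sub X])
  define v where "v k = expectation (\<lambda>x. (X k x)\<^sup>2)" for k
  have v0: "0 \<le> v k" for k by (simp add: v_def)
  have sv: "summable (\<lambda>k. v (k + m))" for m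
    using sm by (intro summable_ignore_initial_segment) (simp add: v_def)
  define A where "A \<epsilon> m n = {x \<in> space M. \<exists>j\<le>n. \<epsilon> \<le> \<bar>\<Sum>k<j. X (k + m) x\<bar>}" for \<epsilon> m n
  have [measurable]: "A \<epsilon> m n \<in> sets M" for \<epsilon> m n unfolding A_def by measurable
  have A: "prob (\<Union>n. A \<epsilon> m n) \<le> (\<Sum>k. v (k + m)) / \<epsilon>\<^sup>2" if \<epsilon>: "0 < \<epsilon>" for \<epsilon> m
  proof -
    have "prob (A \<epsilon> m n) \<le> (\<Sum>k. v (k + m)) / \<epsilon>\<^sup>2" for n
    proof -
      have "prob (A \<epsilon> m n) \<le> (\<Sum>k<n. v (k + m)) / \<epsilon>\<^sup>2"
        unfolding A_def v_def
        by (rule martingale_maximal_inequality[where F="\<lambda>k. F (k + m)"])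
          (use sub mono X X2 X0 \<epsilon> in auto)
      also have "\<dots> \<le> (\<Sum>k. v (k + m)) / \<epsilon>\<^sup>2"
        using \<epsilon> v0 by (intro divide_right_mono sum_le_suminf sv) auto
      finally show ?thesis .
    qed
    moreover have "incseq (A \<epsilon> m)" by (auto simp: incseq_def A_def intro: order_trans)
    then have "(\<lambda>n. prob (A \<epsilon> m n)) \<longlonglongrightarrow> prob (\<Union>n. A \<epsilon> m n)"
      by (intro finite_Lim_measure_incseq) auto
    ultimately show ?thesis by (auto intro: LIMSEQ_le_const2)
  qed
  have null: "AE x in M. \<exists>m. \<forall>n. x \<notin> A \<epsilon> m n" if \<epsilon>: "0 < \<epsilon>" for \<epsilon>
  proof -
    define B where "B = (\<Inter>m. \<Union>n. A \<epsilon> m n)"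
    have [measurable]: "B \<in> sets M" by (simp add: B_def)
    have "prob B \<le> (\<Sum>k. v (k + m)) / \<epsilon>\<^sup>2" for m
      by (rule order_trans[OF finite_measure_mono A[OF \<epsilon>]]) (auto simp: B_def)
    moreover have "summable v" using sm by (simp add: v_def[abs_def])
    then have "(\<lambda>m. (\<Sum>k. v (k + m)) / \<epsilon>\<^sup>2) \<longlonglongrightarrow> 0 / \<epsilon>\<^sup>2"
      using \<epsilon> by (intro tendsto_divide suminf_exist_split2 tendsto_const) auto
    ultimately have "prob B \<le> 0" by (intro LIMSEQ_le_const) auto
    then have "prob B = 0" by (simp add: measure_le_0_iff)
    then have "AE x in M. x \<notin> B" by (simp add: prob_eq_0)
    then show ?thesis by eventually_elim (auto simp: B_def)
  qed
  have "AE x in M. \<forall>i::nat. \<exists>m. \<forall>n. x \<notin> A (1 / real (Suc i)) m n"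
    unfolding AE_all_countable using null by simp
  with AE_space show ?thesis
  proof eventually_elim
    fix x assume x: "x \<in> space M" and *: "\<forall>i::nat. \<exists>m. \<forall>n. x \<notin> A (1 / real (Suc i)) m n"
    show "summable (\<lambda>k. X k x)"
      unfolding summable_Cauchy
    proof (intro allI impI)
      fix e :: real assume "0 < e"
      \<comment> \<open>Half of e, because a block from p to n is the difference of two blocks that
        both start at m.\<close>
      then obtain i where i: "1 / real (Suc i) < e / 2"
        using reals_Archimedean[of "e / 2"] by (auto simp: inverse_eq_divide)
      obtain m where m: "\<And>n. x \<notin> A (1 / real (Suc i)) m n" using * by blast
      have S: "\<bar>sum (\<lambda>k. X k x) {m..<n}\<bar> < e / 2" if "n \<ge> m" for n
      proof -
        have "sum (\<lambda>k. X k x) {m..<n} = (\<Sum>k<n - m. X (k + m) x)"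
          using that sum.shift_bounds_nat_ivl[of "\<lambda>k. X k x" 0 m "n - m"]
          by (simp add: lessThan_atLeast0)
        then show ?thesis using m[of "n - m"] x i by (auto simp: A_def not_le)
      qed
      show "\<exists>N. \<forall>m\<ge>N. \<forall>n. norm (sum (\<lambda>k. X k x) {m..<n}) < e"
      proof (intro exI[of _ m] allI impI)
        fix p n assume p: "m \<le> p"
        show "norm (sum (\<lambda>k. X k x) {p..<n}) < e"
        proof (cases "p \<le> n")
          case True
          then have "sum (\<lambda>k. X k x) {m..<n} = sum (\<lambda>k. X k x) {m..<p} + sum (\<lambda>k. X k x) {p..<n}"
            using p by (simp add: sum.atLeastLessThan_concat)
          then show ?thesis using S[of p] S[of n] p True unfolding real_norm_def by arith
        qed (use \<open>0 < e\<close> in simp)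
      qed
    qed
  qed
qed

end

section \<open>Deterministic stochastic approximation\<close>

text \<open>The noise series may converge only conditionally, so its terms cannot be estimated one
  by one in absolute value; its tail r, however, tends to 0. In the shifted variable the error is
  contracted by \<open>1 - \<zeta> k \<le> exp (- \<zeta> k)\<close> and pulled towards a small
  target, and divergence of the step sizes erases the initial error.\<close>

lemma stochastic_approximation_tracking:
  fixes y a \<xi> \<zeta> :: "nat \<Rightarrow> real"
  assumes step: "\<And>k. y (Suc k) = y k + \<zeta> k * (a k - y k) + \<xi> k"
    and pos: "\<And>k. 0 < \<zeta> k" and \<zeta>0: "\<zeta> \<longlonglongrightarrow> 0"
    and div: "filterlim (\<lambda>n. \<Sum>k<n. \<zeta> k) at_top sequentially"
    and \<xi>: "summable \<xi>" and a: "a \<longlonglongrightarrow> L"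
  shows "y \<longlonglongrightarrow> L"
proof -
  define r where "r k = (\<Sum>j. \<xi> (j + k))" for k
  have r0: "r \<longlonglongrightarrow> 0"
    unfolding r_def by (rule suminf_exist_split2[OF \<xi>])
  have rS: "r k = \<xi> k + r (Suc k)" for k
    using suminf_split_head[OF summable_ignore_initial_segment[OF \<xi>, of k]] by (simp add: r_def)
  \<comment> \<open>Adding the tail of the noise turns the recursion into a noise-free relaxation.\<close>
  define d where "d k = y k + r k - L" for k
  have dS: "d (Suc k) = (1 - \<zeta> k) * d k + \<zeta> k * (a k + r k - L)" for k
    using step[of k] rS[of k] by (simp add: d_def algebra_simps)
  have "d \<longlonglongrightarrow> 0"
  proof (rule LIMSEQ_I)
    fix e :: real assume "0 < e"
    define \<epsilon> where "\<epsilon> = e / 2"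
    have \<epsilon>: "0 < \<epsilon>" using \<open>0 < e\<close> by (simp add: \<epsilon>_def)
    have "(\<lambda>k. a k + r k - L) \<longlonglongrightarrow> L + 0 - L" by (intro tendsto_intros a r0)
    then have "\<forall>\<^sub>F k in sequentially. \<bar>a k + r k - L\<bar> < \<epsilon>"
      using \<epsilon> by (auto simp: tendsto_iff dist_real_def)
    moreover have "\<forall>\<^sub>F k in sequentially. \<zeta> k < 1"
      using \<zeta>0 by (rule order_tendstoD) simp
    ultimately have "\<forall>\<^sub>F k in sequentially. \<bar>a k + r k - L\<bar> < \<epsilon> \<and> \<zeta> k < 1"
      by eventually_elim simp
    then obtain K where K: "\<And>k. k \<ge> K \<Longrightarrow> \<bar>a k + r k - L\<bar> < \<epsilon> \<and> \<zeta> k < 1"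
      by (auto simp: eventually_sequentially)
    \<comment> \<open>Each step is a convex combination of the current error and a quantity below
      \<epsilon>, which is why \<epsilon> appears once and does not accumulate with n.\<close>
    have bound: "\<bar>d (n + K)\<bar> \<le> \<epsilon> + exp (- (\<Sum>j<n. \<zeta> (j + K))) * \<bar>d K\<bar>" for n
    proof (induction n)
      case (Suc n)
      let ?E = "exp (- (\<Sum>j<n. \<zeta> (j + K))) * \<bar>d K\<bar>" and ?z = "\<zeta> (n + K)"
      have z: "0 < ?z" "?z < 1" using pos K by auto
      have "\<bar>d (Suc n + K)\<bar> \<le> (1 - ?z) * \<bar>d (n + K)\<bar> + ?z * \<bar>a (n + K) + r (n + K) - L\<bar>"
        using z abs_triangle_ineq[of "(1 - ?z) * d (n + K)" "?z * (a (n + K) + r (n + K) - L)"]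
        by (simp add: dS abs_mult)
      also have "\<dots> \<le> (1 - ?z) * (\<epsilon> + ?E) + ?z * \<epsilon>"
        using z Suc K[of "n + K"] by (intro add_mono mult_left_mono) auto
      also have "\<dots> = \<epsilon> + (1 - ?z) * ?E" by (simp add: algebra_simps)
      also have "\<dots> \<le> \<epsilon> + exp (- ?z) * ?E"
        using exp_ge_add_one_self[of "- ?z"] by (intro add_mono mult_right_mono) auto
      finally show ?case by (simp add: exp_diff exp_minus divide_inverse mult_ac)
    qed (use \<epsilon> in simp)
    have "filterlim (\<lambda>n. \<Sum>j<n. \<zeta> (j + K)) at_top sequentially"
    proof -
      have "filterlim (\<lambda>n. (\<Sum>k<n + K. \<zeta> k)) at_top sequentially"
        by (rule filterlim_compose[OF div filterlim_add_const_nat_at_top])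
      then have "filterlim (\<lambda>n. - (\<Sum>k<K. \<zeta> k) + (\<Sum>k<n + K. \<zeta> k)) at_top sequentially"
        by (rule filterlim_tendsto_add_at_top[OF tendsto_const])
      moreover have "(\<Sum>k<n + K. \<zeta> k) = (\<Sum>k<K. \<zeta> k) + (\<Sum>j<n. \<zeta> (j + K))" for n
        by (induction n) auto
      ultimately show ?thesis by simp
    qed
    then have "(\<lambda>n. exp (- (\<Sum>j<n. \<zeta> (j + K)))) \<longlonglongrightarrow> 0"
      by (intro filterlim_compose[OF exp_at_bot] filterlim_compose[OF filterlim_uminus_at_bot_at_top])
    then have "(\<lambda>n. exp (- (\<Sum>j<n. \<zeta> (j + K))) * \<bar>d K\<bar>) \<longlonglongrightarrow> 0"
      by (rule tendsto_mult_left_zero)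
    then have "\<forall>\<^sub>F n in sequentially. exp (- (\<Sum>j<n. \<zeta> (j + K))) * \<bar>d K\<bar> < \<epsilon>"
      using \<epsilon> by (rule order_tendstoD)
    then obtain n0 where n0: "\<And>n. n \<ge> n0 \<Longrightarrow> exp (- (\<Sum>j<n. \<zeta> (j + K))) * \<bar>d K\<bar> < \<epsilon>"
      by (auto simp: eventually_sequentially)
    show "\<exists>no. \<forall>n\<ge>no. norm (d n - 0) < e"
    proof (intro exI[of _ "n0 + K"] allI impI)
      fix n assume n: "n \<ge> n0 + K"
      then have "\<bar>d n\<bar> \<le> \<epsilon> + exp (- (\<Sum>j<n - K. \<zeta> (j + K))) * \<bar>d K\<bar>"
        using bound[of "n - K"] by simp
      also have "\<dots> < \<epsilon> + \<epsilon>" using n0[of "n - K"] n by (intro add_strict_left_mono) simp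
      also have "\<dots> = e" by (simp add: \<epsilon>_def)
      finally show "norm (d n - 0) < e" by simp
    qed
  qed
  then have "(\<lambda>k. d k - r k + L) \<longlonglongrightarrow> 0 - 0 + L" by (intro tendsto_intros r0)
  then show ?thesis by (simp add: d_def)
qed

section \<open>The conditional law of the samples\<close>

lemma matrix_inv_sym:
  assumes "A \<in> pos_def_mats"
  shows "matrix_inv A \<in> sym_mats"
proof -
  have tA: "transpose A = A" using assms by (simp add: pos_def_mats_def sym_mats_def)
  have "A ** transpose (matrix_inv A) = transpose (matrix_inv A ** A)"
    by (simp add: matrix_transpose_mul tA)
  also have "\<dots> = mat 1" by (simp add: matrix_inv_pos_def[OF assms])
  finally have "matrix_inv A ** (A ** transpose (matrix_inv A)) = matrix_inv A" by simp
  then show ?thesis by (simp add: matrix_mul_assoc matrix_inv_pos_def[OF assms] sym_mats_def)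
qed

text \<open>With w the solution of \<open>A *v w = u\<close>, the form is
  \<open>w \<bullet> (A *v w)\<close>, at least \<open>l * (norm w)\<^sup>2\<close>; Cauchy-Schwarz
  then gives \<open>norm w \<le> norm u / l\<close>. This is the uniform variance bound for the
  draws.\<close>

lemma matrix_inv_form_bounds:
  assumes l: "0 < l" and A: "A \<in> pos_def_between l \<psi>"
  shows "0 \<le> u \<bullet> (matrix_inv A *v u)" "u \<bullet> (matrix_inv A *v u) \<le> (norm u)\<^sup>2 / l"
proof -
  define w where "w = matrix_inv A *v u"
  have PD: "A \<in> pos_def_mats" using A by (simp add: pos_def_between_def)
  have Aw: "A *v w = u" by (simp add: w_def matrix_inv_pos_def[OF PD])
  have lw: "l * (norm w)\<^sup>2 \<le> u \<bullet> w"
    using A unfolding pos_def_between_eq[OF l] by (metis (mono_tags, lifting) Aw inner_commute mem_Collect_eq power2_norm_eq_inner)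
  moreover have "0 \<le> l * (norm w)\<^sup>2" using l by simp
  ultimately show "0 \<le> u \<bullet> (matrix_inv A *v u)" by (simp add: w_def)
  have "norm w * (l * norm w) \<le> norm w * norm u"
    using lw norm_cauchy_schwarz[of u w] by (simp add: power2_eq_square mult_ac)
  then have "l * norm w \<le> norm u" by (cases "w = 0") (auto simp: mult_le_cancel_left)
  then have "norm w \<le> norm u / l" using l by (simp add: field_simps)
  then have "norm u * norm w \<le> norm u * (norm u / l)" by (rule mult_left_mono) simp
  then show "u \<bullet> (matrix_inv A *v u) \<le> (norm u)\<^sup>2 / l"
    using norm_cauchy_schwarz[of u w] by (simp add: w_def power2_eq_square)
qed

text \<open>The centred normal density parametrized by the precision matrix A. No inverse occurs, so
  joint measurability in A and x follows from continuity of the quadratic form and of the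
  determinant on all matrices.\<close>

definition gauss_density :: "real ^ 'n ^ 'n \<Rightarrow> real ^ 'n \<Rightarrow> real" where
  "gauss_density A x = exp (- (x \<bullet> (A *v x)) / 2) / sqrt ((2 * pi) ^ CARD('n) / det A)"

lemma borel_measurable_gauss_density:
  "(\<lambda>(A, x). gauss_density A x) \<in> borel_measurable (borel \<Otimes>\<^sub>M (borel :: (real ^ 'n) measure))"
proof -
  have "continuous_on UNIV (\<lambda>p :: (real ^ 'n ^ 'n) \<times> (real ^ 'n). snd p \<bullet> (fst p *v snd p))"
    unfolding matrix_vector_mult_def by (intro continuous_intros)
  moreover have "continuous_on UNIV (\<lambda>p :: (real ^ 'n ^ 'n) \<times> (real ^ 'n). det (fst p))"
    unfolding det_def by (intro continuous_intros)
  ultimately have [measurable]: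
    "(\<lambda>p :: (real ^ 'n ^ 'n) \<times> (real ^ 'n). snd p \<bullet> (fst p *v snd p)) \<in> borel_measurable (borel \<Otimes>\<^sub>M borel)"
    "(\<lambda>p :: (real ^ 'n ^ 'n) \<times> (real ^ 'n). det (fst p)) \<in> borel_measurable (borel \<Otimes>\<^sub>M borel)"
    unfolding borel_prod by (auto intro: borel_measurable_continuous_onI)
  show ?thesis unfolding gauss_density_def split_beta by measurable
qed

lemma mv_normal_precision:
  assumes "A \<in> pos_def_mats"
  shows "mv_normal 0 (matrix_inv A) = density lborel (\<lambda>x. ennreal (gauss_density A x))"
proof -
  have "det (matrix_inv A) * det A = 1"
    by (metis assms det_I det_mul matrix_inv_pos_def(1))
  then have "det (matrix_inv A) = 1 / det A"
    using pos_def_det_pos[OF assms] by (simp add: field_simps)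
  then show ?thesis
    by (simp add: mv_normal_def gauss_density_def matrix_inv_pos_def[OF assms])
qed

text \<open>Exponential tilting of a centred Gaussian is a translation, here by t times the solution
  w of \<open>A *v w = u\<close>, up to a constant factor. Lebesgue measure is translation invariant
  and the premise supplies total mass 1, so only the factor remains.\<close>

lemma mv_normal_mgf:
  fixes A :: "real ^ 'n ^ 'n"
  assumes A: "A \<in> pos_def_mats" and "prob_space (mv_normal 0 (matrix_inv A))"
  shows "(\<integral>\<^sup>+x. ennreal (exp (t * (u \<bullet> x))) \<partial>mv_normal 0 (matrix_inv A))
    = ennreal (exp (t\<^sup>2 * (u \<bullet> (matrix_inv A *v u)) / 2))"
proof -
  define w where "w = matrix_inv A *v u"
  have Aw: "A *v w = u" by (simp add: w_def matrix_inv_pos_def[OF A])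
  have sym: "A \<in> sym_mats" using A by (simp add: pos_def_mats_def)
  have [measurable]: "gauss_density A \<in> borel_measurable borel"
    using measurable_compose[OF measurable_Pair1'[of A borel borel] borel_measurable_gauss_density]
    by simp
  interpret prob_space "mv_normal 0 (matrix_inv A)" by (rule assms(2))
  have one: "(\<integral>\<^sup>+x. ennreal (gauss_density A x) \<partial>lborel) = 1"
    using emeasure_space_1 by (simp add: mv_normal_precision[OF A] emeasure_density)
  have g0: "0 \<le> gauss_density A x" for x
    using pos_def_det_pos[OF A] by (simp add: gauss_density_def)
  \<comment> \<open>Completing the square.\<close>
  have eq: "gauss_density A (t *\<^sub>R w + x) * exp (t * (u \<bullet> (t *\<^sub>R w + x)))
      = exp (t\<^sup>2 * (u \<bullet> w) / 2) * gauss_density A x" for x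
  proof -
    have "(t *\<^sub>R w + x) \<bullet> (A *v (t *\<^sub>R w + x)) = t\<^sup>2 * (u \<bullet> w) + 2 * t * (u \<bullet> x) + x \<bullet> (A *v x)"
      using inner_matrix_vector_sym[OF sym, of w x]
      by (simp add: matrix_vector_right_distrib matrix_vector_mult_scaleR Aw inner_add_left
          inner_add_right power2_eq_square inner_commute algebra_simps)
    then have "- ((t *\<^sub>R w + x) \<bullet> (A *v (t *\<^sub>R w + x))) / 2 + t * (u \<bullet> (t *\<^sub>R w + x))
        = t\<^sup>2 * (u \<bullet> w) / 2 + - (x \<bullet> (A *v x)) / 2"
      by (simp add: inner_add_right power2_eq_square field_simps)
    then show ?thesis
      by (simp add: gauss_density_def flip: exp_add)
  qed
  have "(\<integral>\<^sup>+x. ennreal (exp (t * (u \<bullet> x))) \<partial>mv_normal 0 (matrix_inv A))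
      = (\<integral>\<^sup>+x. ennreal (gauss_density A x * exp (t * (u \<bullet> x))) \<partial>lborel)"
    by (simp add: mv_normal_precision[OF A] nn_integral_density g0 ennreal_mult)
  also have "\<dots> = (\<integral>\<^sup>+x. ennreal (gauss_density A x * exp (t * (u \<bullet> x))) \<partial>distr lborel borel ((+) (t *\<^sub>R w)))"
    by (simp add: lborel_distr_plus)
  also have "\<dots> = (\<integral>\<^sup>+x. ennreal (exp (t\<^sup>2 * (u \<bullet> w) / 2)) * ennreal (gauss_density A x) \<partial>lborel)"
    by (subst nn_integral_distr) (auto simp: eq ennreal_mult g0)
  also have "\<dots> = ennreal (exp (t\<^sup>2 * (u \<bullet> w) / 2))"
    by (simp add: nn_integral_cmult one)
  finally show ?thesis by (simp add: w_def)
qed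

lemma mv_normal_moments:
  fixes A :: "real ^ 'n ^ 'n"
  assumes "A \<in> pos_def_mats" and "prob_space (mv_normal 0 (matrix_inv A))"
  shows "(\<integral>\<^sup>+x. ennreal ((u \<bullet> x)\<^sup>2) \<partial>mv_normal 0 (matrix_inv A)) = ennreal (u \<bullet> (matrix_inv A *v u))"
    and "(\<integral>\<^sup>+x. ennreal ((u \<bullet> x) ^ 4) \<partial>mv_normal 0 (matrix_inv A))
      \<le> ennreal (512 * exp (u \<bullet> (matrix_inv A *v u) / 2))"
proof -
  have m: "(\<lambda>x. u \<bullet> x) \<in> borel_measurable (mv_normal 0 (matrix_inv A))"
    by (simp add: mv_normal_def)
  show "(\<integral>\<^sup>+x. ennreal ((u \<bullet> x)\<^sup>2) \<partial>mv_normal 0 (matrix_inv A)) = ennreal (u \<bullet> (matrix_inv A *v u))"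
    and "(\<integral>\<^sup>+x. ennreal ((u \<bullet> x) ^ 4) \<partial>mv_normal 0 (matrix_inv A))
      \<le> ennreal (512 * exp (u \<bullet> (matrix_inv A *v u) / 2))"
    using gaussian_mgf_moments[OF assms(2) m mv_normal_mgf[OF assms, of _ u]] by auto
qed

section \<open>From the sampling hypothesis to integrals over events of the past\<close>

context stoch_prox_process
begin

lemma F_measurable: "f \<in> borel_measurable (F k) \<Longrightarrow> f \<in> borel_measurable M"
  by (rule measurable_from_subalg[OF F_subalgebra])

lemma F_sets: "A \<in> sets (F k) \<Longrightarrow> A \<in> sets M"
  using F_subalgebra[of k] by (auto simp: subalgebra_def)

lemma z_borel: "i \<in> {1..N} \<Longrightarrow> z k i \<in> borel_measurable M"
  using F_measurable z_measurable by blast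

lemma F_finite_subalgebra: "finite_measure_subalgebra M (F k)"
  by unfold_locales (rule F_subalgebra)

text \<open>Sampling with all \<open>A i = UNIV\<close> equates the total mass of \<open>mv_normal\<close>, raised to the power \<open>N\<close>, with
  the conditional expectation of the constant \<open>1\<close>; no Gaussian integral has to be evaluated.\<close>

lemma sampling_prob_space:
  assumes N: "1 \<le> N"
  shows "AE \<omega> in M. (\<forall>j\<le>k. \<theta> j \<omega> \<in> pos_def_mats) \<longrightarrow> prob_space (mv_normal 0 (matrix_inv (\<theta> k \<omega>)))"
proof -
  interpret S: finite_measure_subalgebra M "F k" by (rule F_finite_subalgebra)
  have "(indicator (space M) :: 'w \<Rightarrow> real) \<in> borel_measurable (F k)"
    using F_subalgebra[of k] by (metis borel_measurable_indicator sets.top subalgebra_def)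
  then have "AE \<omega> in M. real_cond_exp M (F k) (indicator (space M)) \<omega> = indicator (space M) \<omega>"
    by (intro S.real_cond_exp_F_meas) (auto simp: emeasure_space_1)
  moreover have "AE \<omega> in M. (\<forall>j\<le>k. \<theta> j \<omega> \<in> pos_def_mats) \<longrightarrow>
      real_cond_exp M (F k) (indicator (space M)) \<omega>
        = measure (mv_normal 0 (matrix_inv (\<theta> k \<omega>))) UNIV ^ N"
    using sampling[of "\<lambda>_. UNIV" k] by simp
  ultimately show ?thesis
    using AE_space
  proof eventually_elim
    fix \<omega>
    let ?\<nu> = "mv_normal 0 (matrix_inv (\<theta> k \<omega>))"
    assume "real_cond_exp M (F k) (indicator (space M)) \<omega> = indicator (space M) \<omega>"
      and "(\<forall>j\<le>k. \<theta> j \<omega> \<in> pos_def_mats) \<longrightarrow>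
      real_cond_exp M (F k) (indicator (space M)) \<omega> = measure ?\<nu> UNIV ^ N"
      and "\<omega> \<in> space M"
    then have "measure ?\<nu> UNIV = 1" if "\<forall>j\<le>k. \<theta> j \<omega> \<in> pos_def_mats"
      using that N power_eq_imp_eq_base[of "measure ?\<nu> UNIV" N 1] by simp
    \<comment> \<open>\<open>measure\<close> returns 0 for infinite mass, so the value 1 excludes
      that case.\<close>
    then have "emeasure ?\<nu> (space ?\<nu>) = 1" if "\<forall>j\<le>k. \<theta> j \<omega> \<in> pos_def_mats"
      using that by (cases "emeasure ?\<nu> UNIV = top")
        (auto simp: measure_def emeasure_eq_ennreal_measure mv_normal_def)
    then show "(\<forall>j\<le>k. \<theta> j \<omega> \<in> pos_def_mats) \<longrightarrow> prob_space ?\<nu>"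
      by (auto intro: prob_spaceI)
  qed
qed

text \<open>Put B in slot i and the whole space in the others, whose factors are 1 because the
  normal law is a probability measure.\<close>

lemma sampling_single:
  assumes i: "i \<in> {1..N}" and B: "B \<in> sets borel"
  shows "AE \<omega> in M. (\<forall>j\<le>k. \<theta> j \<omega> \<in> pos_def_mats) \<longrightarrow>
    real_cond_exp M (F k) (indicator {\<omega>' \<in> space M. z k i \<omega>' \<in> B}) \<omega>
      = measure (mv_normal 0 (matrix_inv (\<theta> k \<omega>))) B"
proof -
  have N: "1 \<le> N" using i by simp
  have set: "{\<omega>' \<in> space M. \<forall>j\<in>{1..N}. z k j \<omega>' \<in> (if j = i then B else UNIV)}
      = {\<omega>' \<in> space M. z k i \<omega>' \<in> B}"
    using i by auto
  have "AE \<omega> in M. (\<forall>j\<le>k. \<theta> j \<omega> \<in> pos_def_mats) \<longrightarrow>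
    real_cond_exp M (F k) (indicator {\<omega>' \<in> space M. z k i \<omega>' \<in> B}) \<omega>
      = (\<Prod>j\<in>{1..N}. measure (mv_normal 0 (matrix_inv (\<theta> k \<omega>))) (if j = i then B else UNIV))"
    using sampling[of "\<lambda>j. if j = i then B else UNIV" k] B unfolding set by simp
  with sampling_prob_space[OF N, of k] show ?thesis
  proof eventually_elim
    fix \<omega>
    let ?\<nu> = "mv_normal 0 (matrix_inv (\<theta> k \<omega>))"
    assume 1: "(\<forall>j\<le>k. \<theta> j \<omega> \<in> pos_def_mats) \<longrightarrow> prob_space ?\<nu>"
      and 2: "(\<forall>j\<le>k. \<theta> j \<omega> \<in> pos_def_mats) \<longrightarrow>
        real_cond_exp M (F k) (indicator {\<omega>' \<in> space M. z k i \<omega>' \<in> B}) \<omega>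
          = (\<Prod>j\<in>{1..N}. measure ?\<nu> (if j = i then B else UNIV))"
    have "(\<Prod>j\<in>{1..N}. measure ?\<nu> (if j = i then B else UNIV)) = measure ?\<nu> B"
      if "prob_space ?\<nu>"
    proof -
      interpret P: prob_space ?\<nu> by (rule that)
      have "measure ?\<nu> UNIV = 1" using P.prob_space by (simp add: mv_normal_def)
      then have "(\<Prod>j\<in>{1..N}. measure ?\<nu> (if j = i then B else UNIV))
          = (\<Prod>j\<in>{1..N}. if j = i then measure ?\<nu> B else 1)"
        by (intro prod.cong) auto
      also have "\<dots> = measure ?\<nu> B" using i by (simp add: prod.delta)
      finally show ?thesis .
    qed
    with 1 2 show "(\<forall>j\<le>k. \<theta> j \<omega> \<in> pos_def_mats) \<longrightarrow>
        real_cond_exp M (F k) (indicator {\<omega>' \<in> space M. z k i \<omega>' \<in> B}) \<omega> = measure ?\<nu> B"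
      by simp
  qed
qed

text \<open>Integrated form of the conditional law. The null set in \<open>sampling\<close> depends
  on the Borel set; integrating over H first removes it, and equality on every Borel set is then
  equality of two measures, valid for all nonnegative f.\<close>

lemma nn_integral_sampling:
  fixes f :: "real ^ 'n \<Rightarrow> ennreal"
  assumes i: "i \<in> {1..N}" and H: "H \<in> sets (F k)"
    and PD: "\<And>\<omega> j. \<omega> \<in> H \<Longrightarrow> j \<le> k \<Longrightarrow> \<theta> j \<omega> \<in> pos_def_mats"
    and f[measurable]: "f \<in> borel_measurable borel"
  shows "(\<integral>\<^sup>+\<omega>. indicator H \<omega> * f (z k i \<omega>) \<partial>M)
    = (\<integral>\<^sup>+\<omega>. indicator H \<omega> * (\<integral>\<^sup>+x. f x \<partial>mv_normal 0 (matrix_inv (\<theta> k \<omega>))) \<partial>M)"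
proof -
  interpret S: finite_measure_subalgebra M "F k" by (rule F_finite_subalgebra)
  interpret P: pair_sigma_finite M "lborel :: (real ^ 'n) measure" by unfold_locales
  have N: "1 \<le> N" using i by simp
  have [measurable]: "\<theta> k \<in> borel_measurable M" by (rule F_measurable[OF \<theta>_adapted])
  have [measurable]: "z k i \<in> borel_measurable M" by (rule z_borel[OF i])
  have [measurable]: "H \<in> sets M" by (rule F_sets[OF H])
  note [measurable] = borel_measurable_gauss_density
  have [measurable]: "(\<lambda>p. gauss_density (\<theta> k (fst p)) (snd p)) \<in> borel_measurable (M \<Otimes>\<^sub>M borel)"
    using measurable_compose[of "\<lambda>p. (\<theta> k (fst p), snd p)", OF _ borel_measurable_gauss_density]
    by simp
  \<comment> \<open>The Lebesgue density of the mixture, over H, of the normal laws with precision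
    \<open>\<theta> k \<omega>\<close>.\<close>
  define h where "h x = (\<integral>\<^sup>+\<omega>. indicator H \<omega> * ennreal (gauss_density (\<theta> k \<omega>) x) \<partial>M)" for x
  have h[measurable]: "h \<in> borel_measurable borel"
    unfolding h_def by (rule borel_measurable_nn_integral) (simp add: split_beta')
  \<comment> \<open>Needed twice: with the indicator of a Borel set to identify the mixture, and
    with f to read off the result.\<close>
  have tonelli: "(\<integral>\<^sup>+x. h x * g x \<partial>lborel)
      = (\<integral>\<^sup>+\<omega>. indicator H \<omega> * (\<integral>\<^sup>+x. g x \<partial>mv_normal 0 (matrix_inv (\<theta> k \<omega>))) \<partial>M)"
    if [measurable]: "g \<in> borel_measurable borel" for g
  proof -
    have "(\<integral>\<^sup>+x. h x * g x \<partial>lborel)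
        = (\<integral>\<^sup>+x. (\<integral>\<^sup>+\<omega>. indicator H \<omega> * ennreal (gauss_density (\<theta> k \<omega>) x) * g x \<partial>M) \<partial>lborel)"
      unfolding h_def by (intro nn_integral_cong nn_integral_multc[symmetric]) measurable
    also have "\<dots> = (\<integral>\<^sup>+\<omega>. (\<integral>\<^sup>+x. indicator H \<omega> * ennreal (gauss_density (\<theta> k \<omega>) x) * g x \<partial>lborel) \<partial>M)"
      by (rule P.Fubini') (simp add: split_beta')
    also have "\<dots> = (\<integral>\<^sup>+\<omega>. indicator H \<omega> * (\<integral>\<^sup>+x. g x \<partial>mv_normal 0 (matrix_inv (\<theta> k \<omega>))) \<partial>M)"
    proof (intro nn_integral_cong)
      fix \<omega> assume "\<omega> \<in> space M"
      have [measurable]: "gauss_density (\<theta> k \<omega>) \<in> borel_measurable borel"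
        using measurable_compose[OF measurable_Pair1'[of "\<theta> k \<omega>" borel borel] borel_measurable_gauss_density]
        by simp
      show "(\<integral>\<^sup>+x. indicator H \<omega> * ennreal (gauss_density (\<theta> k \<omega>) x) * g x \<partial>lborel)
          = indicator H \<omega> * (\<integral>\<^sup>+x. g x \<partial>mv_normal 0 (matrix_inv (\<theta> k \<omega>)))"
        by (cases "\<omega> \<in> H")
          (simp_all add: mv_normal_precision[OF PD] nn_integral_density)
    qed
    finally show ?thesis .
  qed
  have "distr (density M (indicator H)) borel (z k i) = density lborel h"
  proof (rule measure_eqI)
    fix B assume "B \<in> sets (distr (density M (indicator H)) borel (z k i))"
    then have B[measurable]: "B \<in> sets borel" by simp
    define E where "E = {\<omega> \<in> space M. z k i \<omega> \<in> B}"
    have E[measurable]: "E \<in> sets M" unfolding E_def by measurable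
    define c where "c = real_cond_exp M (F k) (indicator E)"
    have iE: "integrable M (indicator E :: 'w \<Rightarrow> real)" by (simp add: emeasure_eq_measure)
    have c_int: "integrable M c" unfolding c_def by (rule S.real_cond_exp_int(1)[OF iE])
    have c_eq: "AE \<omega> in M. (\<forall>j\<le>k. \<theta> j \<omega> \<in> pos_def_mats) \<longrightarrow>
        c \<omega> = measure (mv_normal 0 (matrix_inv (\<theta> k \<omega>))) B"
      using sampling_single[OF i B, of k] by (simp add: c_def E_def)
    have ae: "AE \<omega> in M. indicator H \<omega> * emeasure (mv_normal 0 (matrix_inv (\<theta> k \<omega>))) B
        = ennreal (indicator H \<omega> * c \<omega>) \<and> 0 \<le> indicator H \<omega> * c \<omega>"
      using c_eq sampling_prob_space[OF N, of k]
    proof eventually_elim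
      fix \<omega>
      let ?\<nu> = "mv_normal 0 (matrix_inv (\<theta> k \<omega>))"
      assume 1: "(\<forall>j\<le>k. \<theta> j \<omega> \<in> pos_def_mats) \<longrightarrow> c \<omega> = measure ?\<nu> B"
        and 2: "(\<forall>j\<le>k. \<theta> j \<omega> \<in> pos_def_mats) \<longrightarrow> prob_space ?\<nu>"
      show "indicator H \<omega> * emeasure ?\<nu> B = ennreal (indicator H \<omega> * c \<omega>) \<and> 0 \<le> indicator H \<omega> * c \<omega>"
      proof (cases "\<omega> \<in> H")
        case True
        then interpret Q: prob_space ?\<nu> using PD 2 by blast
        show ?thesis using True PD 1 by (simp add: Q.emeasure_eq_measure)
      qed simp
    qed
    have "emeasure (distr (density M (indicator H)) borel (z k i)) B = emeasure M (H \<inter> E)"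
      by (simp add: emeasure_distr emeasure_density E_def vimage_def Int_def
          conj_commute flip: indicator_inter_arith)
    also have "\<dots> = ennreal (\<integral>\<omega>. indicator H \<omega> * indicator E \<omega> \<partial>M)"
      by (simp add: emeasure_eq_measure flip: indicator_inter_arith)
    also have "(\<integral>\<omega>. indicator H \<omega> * indicator E \<omega> \<partial>M) = (\<integral>\<omega>. indicator H \<omega> * c \<omega> \<partial>M)"
      using S.real_cond_exp_intA[OF iE H] by (simp add: c_def set_lebesgue_integral_def)
    also have "ennreal \<dots> = (\<integral>\<^sup>+\<omega>. ennreal (indicator H \<omega> * c \<omega>) \<partial>M)"
      using integrable_mult_indicator[OF \<open>H \<in> sets M\<close> c_int] ae
      by (intro nn_integral_eq_integral[symmetric]) (auto elim: eventually_mono)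
    also have "\<dots> = (\<integral>\<^sup>+\<omega>. indicator H \<omega> * emeasure (mv_normal 0 (matrix_inv (\<theta> k \<omega>))) B \<partial>M)"
      using ae by (intro nn_integral_cong_AE) (auto elim: eventually_mono)
    also have "\<dots> = (\<integral>\<^sup>+x. h x * indicator B x \<partial>lborel)"
      by (subst tonelli) (simp_all add: mv_normal_def)
    also have "\<dots> = emeasure (density lborel h) B" by (simp add: emeasure_density)
    finally show "emeasure (distr (density M (indicator H)) borel (z k i)) B = emeasure (density lborel h) B" .
  qed simp
  then have "(\<integral>\<^sup>+x. f x \<partial>distr (density M (indicator H)) borel (z k i)) = (\<integral>\<^sup>+x. f x \<partial>density lborel h)"
    by simp
  then show ?thesis
    by (simp add: nn_integral_distr nn_integral_density tonelli)
qed

end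

section \<open>Convergence of the covariance recursion\<close>

context stoch_prox_process
begin

text \<open>The cut-off uses l and \<psi> instead of mere positive definiteness: on this event the
  forms of the inverse are bounded uniformly. It is decided by \<open>F k\<close>, so multiplying by
  its indicator preserves conditional mean 0.\<close>

definition stay :: "real \<Rightarrow> real \<Rightarrow> nat \<Rightarrow> 'w set" where
  "stay l \<psi> k = {\<omega> \<in> space M. \<forall>j\<le>k. \<theta> j \<omega> \<in> pos_def_between l \<psi>}"

lemma stay_sets:
  assumes "0 < l"
  shows "stay l \<psi> k \<in> sets (F k)"
proof -
  have "\<theta> j \<in> borel_measurable (F k)" if "j \<le> k" for j
    by (rule measurable_from_subalg[OF _ \<theta>_adapted[of j]])
      (use that sets_F_mono in \<open>auto simp: subalgebra_def space_F\<close>)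
  moreover have "pos_def_between l \<psi> \<in> sets (borel :: (real ^ 'n ^ 'n) measure)"
    using closed_pos_def_between[OF assms] by (rule borel_closed)
  ultimately have "{\<omega> \<in> space (F k). \<theta> j \<omega> \<in> pos_def_between l \<psi>} \<in> sets (F k)" if "j \<le> k" for j
    using that measurable_sets[of "\<theta> j" "F k" borel "pos_def_between l \<psi>"]
    by (simp add: vimage_def Int_def conj_commute)
  then have "(\<Inter>j\<in>{..k}. {\<omega> \<in> space (F k). \<theta> j \<omega> \<in> pos_def_between l \<psi>}) \<in> sets (F k)"
    by (intro sets.finite_INT) auto
  moreover have "stay l \<psi> k = (\<Inter>j\<in>{..k}. {\<omega> \<in> space (F k). \<theta> j \<omega> \<in> pos_def_between l \<psi>})"
    by (auto simp: stay_def space_F)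
  ultimately show ?thesis by simp
qed

definition cond_var :: "real \<Rightarrow> real \<Rightarrow> real ^ 'n \<Rightarrow> nat \<Rightarrow> 'w \<Rightarrow> real" where
  "cond_var l \<psi> u k \<omega> = indicator (stay l \<psi> k) \<omega> * (u \<bullet> (matrix_inv (\<theta> k \<omega>) *v u))"

text \<open>Both the square and its conditional mean are cut off, so the difference is centred on
  the whole space and vanishes once the trajectory has left. On a trajectory that never leaves it is
  the true fluctuation of one draw.\<close>

definition noise :: "real \<Rightarrow> real \<Rightarrow> real ^ 'n \<Rightarrow> nat \<Rightarrow> nat \<Rightarrow> 'w \<Rightarrow> real" where
  "noise l \<psi> u i k \<omega> = indicator (stay l \<psi> k) \<omega> * (u \<bullet> z k i \<omega>)\<^sup>2 - cond_var l \<psi> u k \<omega>"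

lemma cond_var_measurable:
  assumes l: "0 < l"
  shows "cond_var l \<psi> u k \<in> borel_measurable (F k)"
proof -
  have "continuous_on (pos_def_between l \<psi>) (\<lambda>A. u \<bullet> (matrix_inv A *v u))"
    by (intro continuous_intros continuous_on_matrix_inv_mult l)
  then have "(\<lambda>A. indicator (pos_def_between l \<psi>) A *\<^sub>R (u \<bullet> (matrix_inv A *v u))) \<in> borel_measurable borel"
    by (intro borel_measurable_continuous_on_indicator borel_closed closed_pos_def_between l)
  from measurable_compose[OF \<theta>_adapted[of k] this]
  have [measurable]: "(\<lambda>\<omega>. indicator (pos_def_between l \<psi>) (\<theta> k \<omega>) *\<^sub>R (u \<bullet> (matrix_inv (\<theta> k \<omega>) *v u)))
      \<in> borel_measurable (F k)" .
  note [measurable] = stay_sets[OF l, of \<psi> k]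
  \<comment> \<open>The inner indicator extends the inverse form, continuous on the closed set only,
    by 0 to a Borel function of all matrices; \<open>stay\<close> already forces it to be 1.\<close>
  have "cond_var l \<psi> u k = (\<lambda>\<omega>. indicator (stay l \<psi> k) \<omega> *
      (indicator (pos_def_between l \<psi>) (\<theta> k \<omega>) *\<^sub>R (u \<bullet> (matrix_inv (\<theta> k \<omega>) *v u))))"
    by (auto simp: cond_var_def fun_eq_iff stay_def indicator_def)
  then show ?thesis by (simp only:) measurable
qed

lemma cond_var_bounds:
  assumes l: "0 < l"
  shows "0 \<le> cond_var l \<psi> u k \<omega>" "cond_var l \<psi> u k \<omega> \<le> (norm u)\<^sup>2 / l"
  using matrix_inv_form_bounds[OF l, of "\<theta> k \<omega>" \<psi> u] l
  by (auto simp: cond_var_def stay_def indicator_def)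

text \<open>Equality of the integrals over every H in \<open>F k\<close> characterizes conditional
  mean 0, so second moments give centring. Fourth moments give the variance:
  \<open>(a - c)\<^sup>2 \<le> 2 * a\<^sup>2 + 2 * c\<^sup>2\<close> doubles 512, and the
  conditional mean is at most \<open>(norm u)\<^sup>2 / l\<close>.\<close>

lemma noise_properties:
  assumes l: "0 < l" and i: "i \<in> {1..N}"
  shows "noise l \<psi> u i k \<in> borel_measurable (F (Suc k))"
    and "integrable M (\<lambda>\<omega>. (noise l \<psi> u i k \<omega>)\<^sup>2)"
    and "expectation (\<lambda>\<omega>. (noise l \<psi> u i k \<omega>)\<^sup>2)
      \<le> 1024 * exp ((norm u)\<^sup>2 / l / 2) + 2 * ((norm u)\<^sup>2 / l)\<^sup>2"
    and "integrable M (noise l \<psi> u i k)"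
    and "AE \<omega> in M. real_cond_exp M (F k) (noise l \<psi> u i k) \<omega> = 0"
proof -
  let ?G = "stay l \<psi> k" and ?c = "cond_var l \<psi> u k"
  define b where "b = (norm u)\<^sup>2 / l"
  have N: "1 \<le> N" using i by simp
  have GF: "?G \<in> sets (F k)" by (rule stay_sets[OF l])
  have G[measurable]: "?G \<in> sets M" by (rule F_sets[OF GF])
  have zM[measurable]: "z k i \<in> borel_measurable M" by (rule z_borel[OF i])
  have cF: "?c \<in> borel_measurable (F k)" by (rule cond_var_measurable[OF l])
  have cM[measurable]: "?c \<in> borel_measurable M" by (rule F_measurable[OF cF])
  have sub: "subalgebra (F (Suc k)) (F k)"
    using sets_F_mono[of k "Suc k"] by (auto simp: subalgebra_def space_F)
  show meas: "noise l \<psi> u i k \<in> borel_measurable (F (Suc k))"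
  proof -
    have [measurable]: "?G \<in> sets (F (Suc k))" using GF sub by (auto simp: subalgebra_def)
    have [measurable]: "?c \<in> borel_measurable (F (Suc k))"
      by (rule measurable_from_subalg[OF sub cF])
    have [measurable]: "z k i \<in> borel_measurable (F (Suc k))" by (rule z_measurable[OF i])
    show ?thesis unfolding noise_def by measurable
  qed
  then have nM[measurable]: "noise l \<psi> u i k \<in> borel_measurable M" by (rule F_measurable)
  have PD: "\<theta> j \<omega> \<in> pos_def_mats" if "\<omega> \<in> ?G" "j \<le> k" for \<omega> j
    using that by (auto simp: stay_def pos_def_between_def)
  have second: "(\<integral>\<^sup>+\<omega>. ennreal (indicator H \<omega> * (indicator ?G \<omega> * (u \<bullet> z k i \<omega>)\<^sup>2)) \<partial>M)
      = (\<integral>\<^sup>+\<omega>. ennreal (indicator H \<omega> * ?c \<omega>) \<partial>M)" if H: "H \<in> sets (F k)" for H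
  proof -
    have HG: "H \<inter> ?G \<in> sets (F k)" using H GF by auto
    have "(\<integral>\<^sup>+\<omega>. ennreal (indicator H \<omega> * (indicator ?G \<omega> * (u \<bullet> z k i \<omega>)\<^sup>2)) \<partial>M)
        = (\<integral>\<^sup>+\<omega>. indicator (H \<inter> ?G) \<omega> * ennreal ((u \<bullet> z k i \<omega>)\<^sup>2) \<partial>M)"
      by (intro nn_integral_cong) (auto simp: indicator_def)
    also have "\<dots> = (\<integral>\<^sup>+\<omega>. indicator (H \<inter> ?G) \<omega> *
        (\<integral>\<^sup>+x. ennreal ((u \<bullet> x)\<^sup>2) \<partial>mv_normal 0 (matrix_inv (\<theta> k \<omega>))) \<partial>M)"
      by (rule nn_integral_sampling[OF i HG]) (auto intro: PD)
    also have "\<dots> = (\<integral>\<^sup>+\<omega>. ennreal (indicator H \<omega> * ?c \<omega>) \<partial>M)"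
    proof (rule nn_integral_cong_AE)
      show "AE \<omega> in M. indicator (H \<inter> ?G) \<omega> *
        (\<integral>\<^sup>+x. ennreal ((u \<bullet> x)\<^sup>2) \<partial>mv_normal 0 (matrix_inv (\<theta> k \<omega>))) = ennreal (indicator H \<omega> * ?c \<omega>)"
        using sampling_prob_space[OF N, of k]
      proof eventually_elim
        fix \<omega> assume *: "(\<forall>j\<le>k. \<theta> j \<omega> \<in> pos_def_mats) \<longrightarrow> prob_space (mv_normal 0 (matrix_inv (\<theta> k \<omega>)))"
        show "indicator (H \<inter> ?G) \<omega> *
          (\<integral>\<^sup>+x. ennreal ((u \<bullet> x)\<^sup>2) \<partial>mv_normal 0 (matrix_inv (\<theta> k \<omega>))) = ennreal (indicator H \<omega> * ?c \<omega>)"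
        proof (cases "\<omega> \<in> ?G")
          case True
          then show ?thesis
            using mv_normal_moments(1)[of "\<theta> k \<omega>" u] PD[OF True] *
            by (auto simp: cond_var_def indicator_def)
        qed (simp add: cond_var_def)
      qed
    qed
    finally show ?thesis .
  qed
  have fourth: "(\<integral>\<^sup>+\<omega>. ennreal (indicator ?G \<omega> * (u \<bullet> z k i \<omega>) ^ 4) \<partial>M) \<le> ennreal (512 * exp (b / 2))"
  proof -
    have "(\<integral>\<^sup>+\<omega>. ennreal (indicator ?G \<omega> * (u \<bullet> z k i \<omega>) ^ 4) \<partial>M)
        = (\<integral>\<^sup>+\<omega>. indicator ?G \<omega> * ennreal ((u \<bullet> z k i \<omega>) ^ 4) \<partial>M)"
      by (intro nn_integral_cong) (auto simp: indicator_def)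
    also have "\<dots> = (\<integral>\<^sup>+\<omega>. indicator ?G \<omega> *
        (\<integral>\<^sup>+x. ennreal ((u \<bullet> x) ^ 4) \<partial>mv_normal 0 (matrix_inv (\<theta> k \<omega>))) \<partial>M)"
      by (rule nn_integral_sampling[OF i GF]) (auto intro: PD)
    also have "\<dots> \<le> (\<integral>\<^sup>+\<omega>. ennreal (512 * exp (b / 2)) \<partial>M)"
    proof (rule nn_integral_mono_AE)
      show "AE \<omega> in M. indicator ?G \<omega> *
        (\<integral>\<^sup>+x. ennreal ((u \<bullet> x) ^ 4) \<partial>mv_normal 0 (matrix_inv (\<theta> k \<omega>))) \<le> ennreal (512 * exp (b / 2))"
        using sampling_prob_space[OF N, of k]
      proof eventually_elim
        fix \<omega> assume *: "(\<forall>j\<le>k. \<theta> j \<omega> \<in> pos_def_mats) \<longrightarrow> prob_space (mv_normal 0 (matrix_inv (\<theta> k \<omega>)))"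
        show "indicator ?G \<omega> * (\<integral>\<^sup>+x. ennreal ((u \<bullet> x) ^ 4) \<partial>mv_normal 0 (matrix_inv (\<theta> k \<omega>)))
          \<le> ennreal (512 * exp (b / 2))"
        proof (cases "\<omega> \<in> ?G")
          case True
          then have "(\<integral>\<^sup>+x. ennreal ((u \<bullet> x) ^ 4) \<partial>mv_normal 0 (matrix_inv (\<theta> k \<omega>)))
              \<le> ennreal (512 * exp (u \<bullet> (matrix_inv (\<theta> k \<omega>) *v u) / 2))"
            using PD[OF True] * by (intro mv_normal_moments(2)) auto
          also have "\<dots> \<le> ennreal (512 * exp (b / 2))"
            using cond_var_bounds(2)[OF l, of \<psi> u k \<omega>] True by (intro ennreal_leI) (simp add: cond_var_def b_def)
          finally show ?thesis using True by simp
        qed simp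
      qed
    qed
    also have "\<dots> = ennreal (512 * exp (b / 2))" by (simp add: emeasure_space_1)
    finally show ?thesis .
  qed
  have q4: "integrable M (\<lambda>\<omega>. indicator ?G \<omega> * (u \<bullet> z k i \<omega>) ^ 4)"
    using fourth by (intro integrableI_nonneg) (auto simp: top.extremum_strict less_top[symmetric] le_less_trans[OF _ ennreal_less_top] top_unique)
  have q4_le: "expectation (\<lambda>\<omega>. indicator ?G \<omega> * (u \<bullet> z k i \<omega>) ^ 4) \<le> 512 * exp (b / 2)"
    using fourth nn_integral_eq_integral[OF q4] by simp
  have c_int: "integrable M ?c"
    by (rule integrable_const_bound[where B="b"]) (use cond_var_bounds[OF l] in \<open>auto simp: b_def\<close>)
  have c2: "(?c \<omega>)\<^sup>2 \<le> b\<^sup>2" for \<omega>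
    using cond_var_bounds[OF l, of \<psi> u k \<omega>] by (intro power_mono) (auto simp: b_def)
  have sq_le: "(noise l \<psi> u i k \<omega>)\<^sup>2 \<le> 2 * (indicator ?G \<omega> * (u \<bullet> z k i \<omega>) ^ 4) + 2 * b\<^sup>2" for \<omega>
  proof -
    have "(a - c)\<^sup>2 \<le> 2 * a\<^sup>2 + 2 * c\<^sup>2" for a c :: real
      using zero_le_power2[of "a + c"] by (simp add: power2_eq_square algebra_simps)
    from this[of "indicator ?G \<omega> * (u \<bullet> z k i \<omega>)\<^sup>2" "?c \<omega>"]
    have "(noise l \<psi> u i k \<omega>)\<^sup>2 \<le> 2 * (indicator ?G \<omega> * (u \<bullet> z k i \<omega>)\<^sup>2)\<^sup>2 + 2 * (?c \<omega>)\<^sup>2"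
      by (simp add: noise_def)
    moreover have "(indicator ?G \<omega> * (u \<bullet> z k i \<omega>)\<^sup>2)\<^sup>2 = indicator ?G \<omega> * (u \<bullet> z k i \<omega>) ^ 4"
      by (auto simp: indicator_def)
    ultimately show ?thesis using c2[of \<omega>] by linarith
  qed
  have dom: "integrable M (\<lambda>\<omega>. 2 * (indicator ?G \<omega> * (u \<bullet> z k i \<omega>) ^ 4) + 2 * b\<^sup>2)"
    using q4 by simp
  show n2: "integrable M (\<lambda>\<omega>. (noise l \<psi> u i k \<omega>)\<^sup>2)"
    by (rule Bochner_Integration.integrable_bound[OF dom]) (use sq_le in \<open>auto intro!: AE_I2\<close>)
  have "expectation (\<lambda>\<omega>. (noise l \<psi> u i k \<omega>)\<^sup>2)
      \<le> expectation (\<lambda>\<omega>. 2 * (indicator ?G \<omega> * (u \<bullet> z k i \<omega>) ^ 4) + 2 * b\<^sup>2)"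
    by (intro integral_mono n2 dom sq_le)
  also have "\<dots> = 2 * expectation (\<lambda>\<omega>. indicator ?G \<omega> * (u \<bullet> z k i \<omega>) ^ 4) + 2 * b\<^sup>2"
    using q4 by (simp add: prob_space)
  finally show "expectation (\<lambda>\<omega>. (noise l \<psi> u i k \<omega>)\<^sup>2)
      \<le> 1024 * exp ((norm u)\<^sup>2 / l / 2) + 2 * ((norm u)\<^sup>2 / l)\<^sup>2"
    using q4_le by (simp add: b_def)
  show n1: "integrable M (noise l \<psi> u i k)"
    using integrable_mult_of_squares[of "\<lambda>_. 1" "noise l \<psi> u i k"] n2 by simp
  have q2: "integrable M (\<lambda>\<omega>. indicator ?G \<omega> * (u \<bullet> z k i \<omega>)\<^sup>2)"
    using Bochner_Integration.integrable_add[OF n1 c_int] by (simp add: noise_def)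
  interpret S: finite_measure_subalgebra M "F k" by (rule F_finite_subalgebra)
  show "AE \<omega> in M. real_cond_exp M (F k) (noise l \<psi> u i k) \<omega> = 0"
  proof (rule S.real_cond_exp_charact[OF _ n1])
    fix H assume H: "H \<in> sets (F k)"
    then have HM: "H \<in> sets M" by (rule F_sets)
    have i1: "integrable M (\<lambda>\<omega>. indicator H \<omega> * (indicator ?G \<omega> * (u \<bullet> z k i \<omega>)\<^sup>2))"
      using integrable_mult_indicator[OF HM q2] by simp
    have i2: "integrable M (\<lambda>\<omega>. indicator H \<omega> * ?c \<omega>)"
      using integrable_mult_indicator[OF HM c_int] by simp
    have "expectation (\<lambda>\<omega>. indicator H \<omega> * (indicator ?G \<omega> * (u \<bullet> z k i \<omega>)\<^sup>2))
        = expectation (\<lambda>\<omega>. indicator H \<omega> * ?c \<omega>)"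
      using second[OF H] cond_var_bounds(1)[OF l] i1 i2
      by (subst (1 2) integral_eq_nn_integral) (auto intro: borel_measurable_integrable)
    then show "set_lebesgue_integral M H (noise l \<psi> u i k) = set_lebesgue_integral M H (\<lambda>\<omega>. 0)"
      using i1 i2 by (simp add: set_lebesgue_integral_def noise_def right_diff_distrib)
  qed auto
qed

text \<open>By Cauchy-Schwarz the square of an average is at most the average of the squares. The
  variance of the k-th term is therefore at most a constant times
  \<open>(\<zeta> (Suc k))\<^sup>2\<close>, which is summable.\<close>

lemma noise_series_summable:
  assumes l: "0 < l" and N: "1 \<le> N" and \<zeta>2: "summable (\<lambda>k. (\<zeta> (Suc k))\<^sup>2)"
  shows "AE \<omega> in M. summable (\<lambda>k. \<zeta> (Suc k) * ((1 / real N) * (\<Sum>i\<in>{1..N}. noise l \<psi> u i k \<omega>)))"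
proof -
  define C where "C = 1024 * exp ((norm u)\<^sup>2 / l / 2) + 2 * ((norm u)\<^sup>2 / l)\<^sup>2"
  define X where "X k \<omega> = (\<Sum>i\<in>{1..N}. \<zeta> (Suc k) / real N * noise l \<psi> u i k \<omega>)" for k \<omega>
  note noise = noise_properties[OF l, where \<psi>=\<psi> and u=u]
  have Xeq: "X k \<omega> = \<zeta> (Suc k) / real N * (\<Sum>i\<in>{1..N}. noise l \<psi> u i k \<omega>)" for k \<omega>
    unfolding X_def by (rule sum_distrib_left[symmetric])
  have XF: "X k \<in> borel_measurable (F (Suc k))" for k
    unfolding X_def by (intro borel_measurable_sum borel_measurable_times borel_measurable_const noise(1))
  have XM[measurable]: "X k \<in> borel_measurable M" for k by (rule F_measurable[OF XF])
  have X_sq_le: "(X k \<omega>)\<^sup>2 \<le> (\<zeta> (Suc k))\<^sup>2 / real N * (\<Sum>i\<in>{1..N}. (noise l \<psi> u i k \<omega>)\<^sup>2)" for k \<omega>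
  proof -
    have "(X k \<omega>)\<^sup>2 = (\<zeta> (Suc k) / real N)\<^sup>2 * (\<Sum>i\<in>{1..N}. noise l \<psi> u i k \<omega>)\<^sup>2"
      unfolding Xeq by (rule power_mult_distrib)
    also have "\<dots> \<le> (\<zeta> (Suc k) / real N)\<^sup>2 * (real N * (\<Sum>i\<in>{1..N}. (noise l \<psi> u i k \<omega>)\<^sup>2))"
      using sum_squared_le_sum_of_squares[of "\<lambda>i. noise l \<psi> u i k \<omega>" "{1..N}"]
      by (intro mult_left_mono) (auto simp: mult.commute)
    also have "\<dots> = (\<zeta> (Suc k))\<^sup>2 / real N * (\<Sum>i\<in>{1..N}. (noise l \<psi> u i k \<omega>)\<^sup>2)"
      using N by (simp add: power2_eq_square)
    finally show ?thesis .
  qed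
  have dom: "integrable M (\<lambda>\<omega>. (\<zeta> (Suc k))\<^sup>2 / real N * (\<Sum>i\<in>{1..N}. (noise l \<psi> u i k \<omega>)\<^sup>2))" for k
    by (intro integrable_mult_right Bochner_Integration.integrable_sum noise(2))
  have X2: "integrable M (\<lambda>\<omega>. (X k \<omega>)\<^sup>2)" for k
  proof (rule Bochner_Integration.integrable_bound[OF dom[of k]])
    show "AE \<omega> in M. norm ((X k \<omega>)\<^sup>2)
        \<le> norm ((\<zeta> (Suc k))\<^sup>2 / real N * (\<Sum>i\<in>{1..N}. (noise l \<psi> u i k \<omega>)\<^sup>2))"
      unfolding real_norm_def abs_power2 by (intro AE_I2 order_trans[OF X_sq_le abs_ge_self])
  qed simp
  have EX2: "expectation (\<lambda>\<omega>. (X k \<omega>)\<^sup>2) \<le> (\<zeta> (Suc k))\<^sup>2 * C" for k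
  proof -
    have "expectation (\<lambda>\<omega>. (X k \<omega>)\<^sup>2)
        \<le> expectation (\<lambda>\<omega>. (\<zeta> (Suc k))\<^sup>2 / real N * (\<Sum>i\<in>{1..N}. (noise l \<psi> u i k \<omega>)\<^sup>2))"
      by (intro integral_mono X2 dom X_sq_le)
    also have "\<dots> = (\<zeta> (Suc k))\<^sup>2 / real N * (\<Sum>i\<in>{1..N}. expectation (\<lambda>\<omega>. (noise l \<psi> u i k \<omega>)\<^sup>2))"
      by (simp add: Bochner_Integration.integral_sum noise(2))
    also have "\<dots> \<le> (\<zeta> (Suc k))\<^sup>2 / real N * (\<Sum>i\<in>{1..N}. C)"
      by (intro mult_left_mono sum_mono noise(3)[folded C_def]) auto
    also have "\<dots> = (\<zeta> (Suc k))\<^sup>2 * C" using N by simp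
    finally show ?thesis .
  qed
  have X0: "AE \<omega> in M. real_cond_exp M (F k) (X k) \<omega> = 0" for k
  proof -
    interpret S: finite_measure_subalgebra M "F k" by (rule F_finite_subalgebra)
    \<comment> \<open>\<open>real_cond_exp_sum\<close> wants integrability for all indices, also those outside \<open>{1..N}\<close>.\<close>
    define g where "g i = (if i \<in> {1..N} then (\<lambda>\<omega>. \<zeta> (Suc k) / real N * noise l \<psi> u i k \<omega>) else (\<lambda>_. 0))" for i
    have "integrable M (g i)" for i
      unfolding g_def using noise(4)[of i k] by (auto split: if_splits)
    then have "AE \<omega> in M. real_cond_exp M (F k) (\<lambda>\<omega>. \<Sum>i\<in>{1..N}. g i \<omega>) \<omega>
        = (\<Sum>i\<in>{1..N}. real_cond_exp M (F k) (g i) \<omega>)"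
      by (rule S.real_cond_exp_sum)
    moreover have "AE \<omega> in M. \<forall>i\<in>{1..N}. real_cond_exp M (F k) (g i) \<omega> = 0"
    proof (intro AE_finite_allI)
      fix i assume i: "i \<in> {1..N}"
      have gi: "g i = (\<lambda>\<omega>. \<zeta> (Suc k) / real N * noise l \<psi> u i k \<omega>)" using i by (simp add: g_def)
      show "AE \<omega> in M. real_cond_exp M (F k) (g i) \<omega> = 0"
        unfolding gi
        using S.real_cond_exp_cmult[OF noise(4)[OF i, of k], of "\<zeta> (Suc k) / real N"] noise(5)[OF i, of k]
        by eventually_elim simp
    qed simp
    ultimately have "AE \<omega> in M. real_cond_exp M (F k) (\<lambda>\<omega>. \<Sum>i\<in>{1..N}. g i \<omega>) \<omega> = 0"
      by eventually_elim simp
    moreover have "X k = (\<lambda>\<omega>. \<Sum>i\<in>{1..N}. g i \<omega>)"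
      by (simp add: X_def[abs_def] g_def)
    ultimately show ?thesis by (simp only:)
  qed
  have "AE \<omega> in M. summable (\<lambda>k. X k \<omega>)"
  proof (rule martingale_differences_summable[where F=F and X=X, OF F_subalgebra sets_F_mono XF X2 X0])
    show "summable (\<lambda>k. expectation (\<lambda>\<omega>. (X k \<omega>)\<^sup>2))"
      using EX2 by (intro summable_comparison_test'[OF summable_mult2[OF \<zeta>2, of C], of 0]) auto
  qed
  then show ?thesis by (simp add: Xeq)
qed

text \<open>\<Theta> is quantified inside the almost sure statement: the null set is that of the
  noise series and depends on u alone. Off it the recursion is a deterministic tracking
  problem.\<close>

lemma covariance_form_tracks:
  assumes l: "0 < l" and N: "1 \<le> N" and \<zeta>2: "summable (\<lambda>k. (\<zeta> (Suc k))\<^sup>2)"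
    and pos: "\<And>k. 1 \<le> k \<Longrightarrow> 0 < \<zeta> k"
    and div: "filterlim (\<lambda>n. \<Sum>k=1..n. \<zeta> k) at_top sequentially"
  shows "AE \<omega> in M. \<forall>\<Theta>. (\<forall>k. \<theta> k \<omega> \<in> pos_def_between l \<psi>) \<longrightarrow> (\<lambda>k. \<theta> k \<omega>) \<longlonglongrightarrow> \<Theta> \<longrightarrow>
    (\<lambda>k. u \<bullet> (\<Sigma> k \<omega> *v u)) \<longlonglongrightarrow> u \<bullet> (matrix_inv \<Theta> *v u)"
  using noise_series_summable[OF l N \<zeta>2, of \<psi> u] AE_space
proof (eventually_elim, intro allI impI)
  fix \<omega> \<Theta>
  assume sm: "summable (\<lambda>k. \<zeta> (Suc k) * (1 / real N * (\<Sum>i\<in>{1..N}. noise l \<psi> u i k \<omega>)))"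
    and \<omega>: "\<omega> \<in> space M" and stay: "\<forall>k. \<theta> k \<omega> \<in> pos_def_between l \<psi>"
    and lim: "(\<lambda>k. \<theta> k \<omega>) \<longlonglongrightarrow> \<Theta>"
  have \<Theta>: "\<Theta> \<in> pos_def_between l \<psi>"
    by (rule closed_sequentially[OF closed_pos_def_between[OF l] _ lim]) (use stay in auto)
  have PD: "\<forall>j\<le>k. \<theta> j \<omega> \<in> pos_def_mats" for k using stay by (simp add: pos_def_between_def)
  have G: "\<omega> \<in> stay l \<psi> k" for k using stay \<omega> by (simp add: stay_def)
  have "linear (\<lambda>A :: real ^ 'n ^ 'n. u \<bullet> (A *v u))"
    by (rule linearI)
      (simp_all add: matrix_vector_mult_add_rdistrib inner_add_right scaleR_matrix_vector_assoc[symmetric])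
  then interpret L: linear "\<lambda>A :: real ^ 'n ^ 'n. u \<bullet> (A *v u)" .
  have outer: "u \<bullet> (outer_square x *v u) = (u \<bullet> x)\<^sup>2" for x
    by (simp add: outer_square_def matrix_vector_mult_def inner_vec_def power2_eq_square
        sum_product sum_distrib_left mult_ac)
  let ?a = "\<lambda>k. u \<bullet> (matrix_inv (\<theta> k \<omega>) *v u)"
  show "(\<lambda>k. u \<bullet> (\<Sigma> k \<omega> *v u)) \<longlonglongrightarrow> u \<bullet> (matrix_inv \<Theta> *v u)"
  proof (rule stochastic_approximation_tracking[where \<zeta>="\<lambda>k. \<zeta> (Suc k)" and a="?a", OF _ _ _ _ sm])
    fix k
    \<comment> \<open>The trajectory never leaves, so all indicators are 1 and the averaged noise is
      the averaged square minus its conditional mean. Substituting this exhibits the recursion as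
      relaxation plus noise.\<close>
    have e: "(1 / real N) * (\<Sum>i\<in>{1..N}. noise l \<psi> u i k \<omega>)
        = (1 / real N) * (\<Sum>i\<in>{1..N}. (u \<bullet> z k i \<omega>)\<^sup>2) - ?a k"
      using N G[of k] by (simp add: noise_def cond_var_def sum_subtractf right_diff_distrib)
    show "u \<bullet> (\<Sigma> (Suc k) \<omega> *v u) = u \<bullet> (\<Sigma> k \<omega> *v u) + \<zeta> (Suc k) * (?a k - u \<bullet> (\<Sigma> k \<omega> *v u))
        + \<zeta> (Suc k) * (1 / real N * (\<Sum>i\<in>{1..N}. noise l \<psi> u i k \<omega>))"
      unfolding \<Sigma>_step[OF \<omega> PD] L.add L.scale L.diff L.sum outer real_scaleR_def e
      by (simp add: right_diff_distrib)
    show "0 < \<zeta> (Suc k)" by (rule pos) simp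
  next
    have "(\<lambda>k. sqrt ((\<zeta> (Suc k))\<^sup>2)) \<longlonglongrightarrow> sqrt 0"
      by (intro tendsto_real_sqrt summable_LIMSEQ_zero \<zeta>2)
    moreover have "sqrt ((\<zeta> (Suc k))\<^sup>2) = \<zeta> (Suc k)" for k using pos[of "Suc k"] by simp
    ultimately show "(\<lambda>k. \<zeta> (Suc k)) \<longlonglongrightarrow> 0" by simp
  next
    show "filterlim (\<lambda>n. \<Sum>k<n. \<zeta> (Suc k)) at_top sequentially"
      using div by (simp add: sum.atLeast1_atMost_eq)
  next
    have "(\<lambda>k. matrix_inv (\<theta> k \<omega>) *v u) \<longlonglongrightarrow> matrix_inv \<Theta> *v u"
      using stay by (intro continuous_on_tendsto_compose[OF continuous_on_matrix_inv_mult[OF l, of \<psi>] lim \<Theta>]) auto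
    then show "?a \<longlonglongrightarrow> u \<bullet> (matrix_inv \<Theta> *v u)" by (intro tendsto_intros)
  qed
qed

end

section \<open>The proximal map and the objective\<close>

lemma elastic_net_nonneg: "0 \<le> lam \<Longrightarrow> 0 \<le> \<alpha> \<Longrightarrow> \<alpha> \<le> 1 \<Longrightarrow> 0 \<le> elastic_net lam \<alpha> A"
  unfolding elastic_net_def by (intro sum_nonneg add_nonneg_nonneg mult_nonneg_nonneg) auto

lemma tendsto_elastic_net:
  "(f \<longlongrightarrow> A) F \<Longrightarrow> ((\<lambda>x. elastic_net lam \<alpha> (f x)) \<longlongrightarrow> elastic_net lam \<alpha> A) F"
  unfolding elastic_net_def by (intro tendsto_intros)

lemma elastic_net_convex:
  assumes "0 \<le> lam" "0 \<le> \<alpha>" "\<alpha> \<le> 1" and t: "0 \<le> t" "t \<le> 1"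
  shows "elastic_net lam \<alpha> ((1 - t) *\<^sub>R A + t *\<^sub>R B) \<le> (1 - t) * elastic_net lam \<alpha> A + t * elastic_net lam \<alpha> B"
proof -
  have "\<alpha> * lam * \<bar>(1 - t) * a + t * b\<bar> + (1 - \<alpha>) / 2 * lam * ((1 - t) * a + t * b)\<^sup>2
      \<le> (1 - t) * (\<alpha> * lam * \<bar>a\<bar> + (1 - \<alpha>) / 2 * lam * a\<^sup>2) + t * (\<alpha> * lam * \<bar>b\<bar> + (1 - \<alpha>) / 2 * lam * b\<^sup>2)"
    for a b :: real
  proof -
    have "\<bar>(1 - t) * a + t * b\<bar> \<le> (1 - t) * \<bar>a\<bar> + t * \<bar>b\<bar>"
      using t abs_triangle_ineq[of "(1 - t) * a" "t * b"] by (simp add: abs_mult)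
    then have "\<alpha> * lam * \<bar>(1 - t) * a + t * b\<bar> \<le> \<alpha> * lam * ((1 - t) * \<bar>a\<bar> + t * \<bar>b\<bar>)"
      using assms by (intro mult_left_mono) auto
    moreover have "((1 - t) * a + t * b)\<^sup>2 \<le> (1 - t) * a\<^sup>2 + t * b\<^sup>2"
    proof -
      have "(1 - t) * a\<^sup>2 + t * b\<^sup>2 - ((1 - t) * a + t * b)\<^sup>2 = t * (1 - t) * (a - b)\<^sup>2"
        by (simp add: power2_eq_square algebra_simps)
      moreover have "0 \<le> t * (1 - t) * (a - b)\<^sup>2" using t by simp
      ultimately show ?thesis by linarith
    qed
    then have "(1 - \<alpha>) / 2 * lam * ((1 - t) * a + t * b)\<^sup>2 \<le> (1 - \<alpha>) / 2 * lam * ((1 - t) * a\<^sup>2 + t * b\<^sup>2)"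
      using assms by (intro mult_left_mono) auto
    ultimately have "\<alpha> * lam * \<bar>(1 - t) * a + t * b\<bar> + (1 - \<alpha>) / 2 * lam * ((1 - t) * a + t * b)\<^sup>2
        \<le> \<alpha> * lam * ((1 - t) * \<bar>a\<bar> + t * \<bar>b\<bar>) + (1 - \<alpha>) / 2 * lam * ((1 - t) * a\<^sup>2 + t * b\<^sup>2)"
      by (rule add_mono)
    moreover have "c * ((1 - t) * x + t * y) + d * ((1 - t) * v + t * w)
        = (1 - t) * (c * x + d * v) + t * (c * y + d * w)" for c d x y v w :: real
      by (simp add: algebra_simps)
    ultimately show ?thesis by (simp only:)
  qed
  then show ?thesis
    unfolding elastic_net_def sum_distrib_left sum.distrib[symmetric]
    by (intro sum_mono) simp
qed

text \<open>\<open>arg_min\<close> is a choice, informative only once a minimizer exists. Outside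
  the ball of radius \<open>norm A\<close> about A the quadratic term alone is at least the value at
  0, where the penalty vanishes, so a minimum over the compact part is global.\<close>

lemma prox_optimal:
  fixes A :: "real ^ 'n ^ 'n"
  assumes "0 \<le> lam" "0 \<le> \<alpha>" "\<alpha> \<le> 1" and \<gamma>: "0 < \<gamma>" and U: "U \<in> sym_mats"
  shows "elastic_net lam \<alpha> (prox lam \<alpha> \<gamma> A) + 1 / (2 * \<gamma>) * (norm (prox lam \<alpha> \<gamma> A - A))\<^sup>2
    \<le> elastic_net lam \<alpha> U + 1 / (2 * \<gamma>) * (norm (U - A))\<^sup>2"
proof -
  define h where "h U = elastic_net lam \<alpha> U + 1 / (2 * \<gamma>) * (norm (U - A))\<^sup>2" for U
  define K where "K = sym_mats \<inter> cball A (norm A)"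
  have "continuous_on UNIV (\<lambda>A :: real ^ 'n ^ 'n. transpose A)"
    unfolding transpose_def by (intro continuous_intros)
  then have "closed (sym_mats :: (real ^ 'n ^ 'n) set)"
    unfolding sym_mats_def by (intro closed_Collect_eq continuous_intros)
  then have "compact K" unfolding K_def by (intro closed_Int_compact) auto
  moreover have 0: "0 \<in> K"
    by (auto simp: K_def sym_mats_def transpose_def vec_eq_iff dist_norm)
  moreover have "continuous_on K h"
    unfolding h_def elastic_net_def by (intro continuous_intros)
  ultimately obtain P where P: "P \<in> K" "\<And>U. U \<in> K \<Longrightarrow> h P \<le> h U"
    using continuous_attains_inf[of K h] by auto
  have "h P \<le> h U" if "U \<in> sym_mats" for U
  proof (cases "U \<in> K")
    case False
    then have "norm A \<le> norm (U - A)" using that by (simp add: K_def dist_norm norm_minus_commute)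
    then have "1 / (2 * \<gamma>) * (norm A)\<^sup>2 \<le> 1 / (2 * \<gamma>) * (norm (U - A))\<^sup>2"
      using \<gamma> by (intro mult_left_mono power_mono) auto
    moreover have "h 0 = 1 / (2 * \<gamma>) * (norm A)\<^sup>2" by (simp add: h_def elastic_net_def)
    moreover have "h P \<le> h 0" by (rule P(2)[OF 0])
    moreover have "0 \<le> elastic_net lam \<alpha> U" using assms(1-3) by (rule elastic_net_nonneg)
    ultimately show ?thesis by (simp add: h_def)
  qed (rule P(2))
  moreover have "P \<in> sym_mats" using P by (simp add: K_def)
  ultimately have "is_arg_min h (\<lambda>U. U \<in> sym_mats) P"
    by (auto simp: is_arg_min_def not_less)
  then have "is_arg_min h (\<lambda>U. U \<in> sym_mats) (arg_min h (\<lambda>U. U \<in> sym_mats))"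
    unfolding arg_min_def by (rule someI)
  moreover have "prox lam \<alpha> \<gamma> A = arg_min h (\<lambda>U. U \<in> sym_mats)"
    by (simp add: prox_def h_def[abs_def])
  ultimately have "h (prox lam \<alpha> \<gamma> A) \<le> h U" using U by (auto simp: is_arg_min_def not_less)
  then show ?thesis by (simp add: h_def)
qed

text \<open>Compare \<Theta> with the point at parameter t on the segment to U. Convexity makes the
  penalty at most linear in t, the quadratic term contributes \<open>G \<bullet> D\<close> at first
  order, and dividing by t and letting t tend to 0 removes the rest. In effect -G is a subgradient
  of the penalty at \<Theta> along symmetric directions.\<close>

lemma prox_fixed_point_ineq:
  fixes \<Theta> G U :: "real ^ 'n ^ 'n"
  assumes lam: "0 \<le> lam" "0 \<le> \<alpha>" "\<alpha> \<le> 1" and \<gamma>: "0 < \<gamma>"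
    and \<Theta>: "\<Theta> \<in> sym_mats" and U: "U \<in> sym_mats"
    and opt: "\<And>V. V \<in> sym_mats \<Longrightarrow>
      elastic_net lam \<alpha> \<Theta> + 1 / (2 * \<gamma>) * (norm (\<Theta> - (\<Theta> - \<gamma> *\<^sub>R G)))\<^sup>2
      \<le> elastic_net lam \<alpha> V + 1 / (2 * \<gamma>) * (norm (V - (\<Theta> - \<gamma> *\<^sub>R G)))\<^sup>2"
  shows "elastic_net lam \<alpha> \<Theta> \<le> elastic_net lam \<alpha> U + G \<bullet> (U - \<Theta>)"
proof -
  define D where "D = U - \<Theta>"
  let ?g = "elastic_net lam \<alpha>"
  have key: "?g \<Theta> - ?g U - G \<bullet> D \<le> t * ((norm D)\<^sup>2 / (2 * \<gamma>))" if t: "0 < t" "t \<le> 1" for t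
  proof -
    define V where "V = (1 - t) *\<^sub>R \<Theta> + t *\<^sub>R U"
    have "V \<in> sym_mats"
      using \<Theta> U by (auto simp: V_def sym_mats_def transpose_def vec_eq_iff)
    then have "?g \<Theta> + 1 / (2 * \<gamma>) * (norm (\<gamma> *\<^sub>R G))\<^sup>2 \<le> ?g V + 1 / (2 * \<gamma>) * (norm (V - (\<Theta> - \<gamma> *\<^sub>R G)))\<^sup>2"
      using opt[of V] by simp
    also have "V - (\<Theta> - \<gamma> *\<^sub>R G) = t *\<^sub>R D + \<gamma> *\<^sub>R G"
      by (simp add: V_def D_def algebra_simps)
    also have "(norm (t *\<^sub>R D + \<gamma> *\<^sub>R G))\<^sup>2 = t\<^sup>2 * (norm D)\<^sup>2 + 2 * t * \<gamma> * (G \<bullet> D) + (norm (\<gamma> *\<^sub>R G))\<^sup>2"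
      unfolding power2_norm_eq_inner
      by (simp add: inner_add_left inner_add_right inner_commute[of G D] power2_eq_square algebra_simps)
    also have "?g V \<le> (1 - t) * ?g \<Theta> + t * ?g U"
      unfolding V_def using lam t by (intro elastic_net_convex) auto
    finally have "?g \<Theta> \<le> (1 - t) * ?g \<Theta> + t * ?g U + 1 / (2 * \<gamma>) * (t\<^sup>2 * (norm D)\<^sup>2 + 2 * t * \<gamma> * (G \<bullet> D))"
      by (simp add: distrib_left)
    also have "1 / (2 * \<gamma>) * (t\<^sup>2 * (norm D)\<^sup>2 + 2 * t * \<gamma> * (G \<bullet> D)) = t * (t * ((norm D)\<^sup>2 / (2 * \<gamma>)) + G \<bullet> D)"
      using \<gamma> by (simp add: field_simps power2_eq_square)
    finally have "t * (?g \<Theta> - ?g U - G \<bullet> D) \<le> t * (t * ((norm D)\<^sup>2 / (2 * \<gamma>)))"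
      by (simp add: algebra_simps)
    then show ?thesis using t by (simp only: mult_le_cancel_left_pos)
  qed
  have "(\<lambda>n. inverse (real (Suc n)) * ((norm D)\<^sup>2 / (2 * \<gamma>))) \<longlonglongrightarrow> 0"
    by (rule tendsto_mult_left_zero[OF LIMSEQ_inverse_real_of_nat])
  moreover have "?g \<Theta> - ?g U - G \<bullet> D \<le> inverse (real (Suc n)) * ((norm D)\<^sup>2 / (2 * \<gamma>))" for n
    by (rule key) (auto simp: inverse_eq_divide)
  ultimately have "?g \<Theta> - ?g U - G \<bullet> D \<le> 0" by (intro LIMSEQ_le_const) auto
  then show ?thesis by (simp add: D_def)
qed

lemma trace_mult_eq_inner:
  fixes A B :: "real ^ 'n ^ 'n"
  assumes "B \<in> sym_mats"
  shows "trace (A ** B) = A \<bullet> B"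
proof -
  have "B $ j $ i = B $ i $ j" for i j
    using assms by (simp add: sym_mats_def transpose_def vec_eq_iff)
  then show ?thesis by (simp add: trace_def matrix_matrix_mult_def inner_vec_def)
qed

text \<open>Add the subgradient inequality for the penalty to the strict tangent inequality for
  \<open>- ln det\<close>; the linear terms in \<open>U - \<Theta>\<close> cancel.\<close>

lemma objective_less:
  fixes S \<Theta> U :: "real ^ 'n ^ 'n"
  assumes S: "S \<in> sym_mats" and \<Theta>: "\<Theta> \<in> pos_def_mats" and U: "U \<in> pos_def_mats" and ne: "U \<noteq> \<Theta>"
    and le: "elastic_net lam \<alpha> \<Theta> \<le> elastic_net lam \<alpha> U + (S - matrix_inv \<Theta>) \<bullet> (U - \<Theta>)"
  shows "objective S lam \<alpha> \<Theta> < objective S lam \<alpha> U"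
proof -
  have sym: "U - \<Theta> \<in> sym_mats"
    using U \<Theta> by (simp add: pos_def_mats_def sym_mats_def transpose_def vec_eq_iff)
  have "ln (det U) < ln (det \<Theta>) + matrix_inv \<Theta> \<bullet> (U - \<Theta>)"
    using ln_det_strict_concave[OF \<Theta> U ne] by (simp add: trace_mult_eq_inner[OF sym])
  then show ?thesis
    using le by (simp add: objective_def neg_loglik_def trace_mult_eq_inner[OF S] inner_diff_left
        inner_diff_right inner_commute)
qed

text \<open>The diagonal entries come from the same family of vectors: \<open>e a a\<close> is twice
  a basis vector, hence the quarters. One family indexed by pairs then suffices.\<close>

lemma sym_mats_polarization:
  fixes A :: "real ^ 'n ^ 'n"
  assumes "A \<in> sym_mats"
  defines "e \<equiv> \<lambda>a b. axis a 1 + axis b 1"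
  shows "A $ a $ b = (e a b \<bullet> (A *v e a b) - (e a a \<bullet> (A *v e a a)) / 4 - (e b b \<bullet> (A *v e b b)) / 4) / 2"
proof -
  have "A $ b $ a = A $ a $ b"
    using assms by (simp add: sym_mats_def transpose_def vec_eq_iff)
  moreover have "(x + x) \<bullet> (A *v (x + x)) = 4 * (x \<bullet> (A *v x))" for x
    by (simp only: scaleR_2[symmetric] matrix_vector_mult_scaleR) simp
  ultimately show ?thesis unfolding e_def
    by (simp only:) (simp add: matrix_vector_right_distrib inner_add_left inner_add_right inner_axis'
        matrix_vector_mult_basis column_def)
qed

section \<open>Convergence to the minimizer\<close>

context stoch_prox_process
begin

lemma \<Sigma>_sym:
  assumes \<Sigma>0: "\<Sigma>0 \<in> sym_mats" and \<omega>: "\<omega> \<in> space M"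
    and PD: "\<And>k. \<theta> k \<omega> \<in> pos_def_mats"
  shows "\<Sigma> k \<omega> \<in> sym_mats"
proof (induction k)
  case (Suc k)
  have "transpose (outer_square x) = outer_square x" for x :: "real ^ 'n"
    by (simp add: outer_square_def transpose_def vec_eq_iff mult.commute)
  then show ?case
    using Suc \<Sigma>_step[OF \<omega>, of k] PD
    by (simp add: sym_mats_def transpose_def vec_eq_iff)
qed (use \<Sigma>0 \<Sigma>_init \<omega> in auto)

text \<open>Only finitely many vectors \<open>e a b\<close> are needed, so their null sets can be
  united; symmetry of both the averages and the limit lets polarization return to entries.\<close>

lemma covariance_tracks:
  assumes l: "0 < l" and N: "1 \<le> N" and \<zeta>2: "summable (\<lambda>k. (\<zeta> (Suc k))\<^sup>2)"
    and pos: "\<And>k. 1 \<le> k \<Longrightarrow> 0 < \<zeta> k"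
    and div: "filterlim (\<lambda>n. \<Sum>k=1..n. \<zeta> k) at_top sequentially"
    and \<Sigma>0: "\<Sigma>0 \<in> sym_mats"
  shows "AE \<omega> in M. \<forall>\<Theta>. (\<forall>k. \<theta> k \<omega> \<in> pos_def_between l \<psi>) \<longrightarrow> (\<lambda>k. \<theta> k \<omega>) \<longlonglongrightarrow> \<Theta> \<longrightarrow>
    (\<lambda>k. \<Sigma> k \<omega>) \<longlonglongrightarrow> matrix_inv \<Theta>"
proof -
  define e :: "'n \<Rightarrow> 'n \<Rightarrow> real ^ 'n" where "e a b = axis a 1 + axis b 1" for a b
  have "AE \<omega> in M. \<forall>a\<in>UNIV. \<forall>b\<in>UNIV. \<forall>\<Theta>.
      (\<forall>k. \<theta> k \<omega> \<in> pos_def_between l \<psi>) \<longrightarrow> (\<lambda>k. \<theta> k \<omega>) \<longlonglongrightarrow> \<Theta> \<longrightarrow>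
      (\<lambda>k. e a b \<bullet> (\<Sigma> k \<omega> *v e a b)) \<longlonglongrightarrow> e a b \<bullet> (matrix_inv \<Theta> *v e a b)"
    by (intro AE_finite_allI covariance_form_tracks[OF l N \<zeta>2 pos div]) auto
  with AE_space show ?thesis
  proof (eventually_elim, intro allI impI)
    fix \<omega> \<Theta>
    assume \<omega>: "\<omega> \<in> space M" and stay: "\<forall>k. \<theta> k \<omega> \<in> pos_def_between l \<psi>"
      and lim: "(\<lambda>k. \<theta> k \<omega>) \<longlonglongrightarrow> \<Theta>"
      and *: "\<forall>a\<in>UNIV. \<forall>b\<in>UNIV. \<forall>\<Theta>.
        (\<forall>k. \<theta> k \<omega> \<in> pos_def_between l \<psi>) \<longrightarrow> (\<lambda>k. \<theta> k \<omega>) \<longlonglongrightarrow> \<Theta> \<longrightarrow>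
        (\<lambda>k. e a b \<bullet> (\<Sigma> k \<omega> *v e a b)) \<longlonglongrightarrow> e a b \<bullet> (matrix_inv \<Theta> *v e a b)"
    then have forms: "(\<lambda>k. e a b \<bullet> (\<Sigma> k \<omega> *v e a b)) \<longlonglongrightarrow> e a b \<bullet> (matrix_inv \<Theta> *v e a b)" for a b
      by blast
    have "\<Theta> \<in> pos_def_between l \<psi>"
      by (rule closed_sequentially[OF closed_pos_def_between[OF l] _ lim]) (use stay in auto)
    then have symI: "matrix_inv \<Theta> \<in> sym_mats" by (intro matrix_inv_sym) (simp add: pos_def_between_def)
    have symS: "\<Sigma> k \<omega> \<in> sym_mats" for k
      by (rule \<Sigma>_sym[OF \<Sigma>0 \<omega>]) (use stay in \<open>simp add: pos_def_between_def\<close>)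
    show "(\<lambda>k. \<Sigma> k \<omega>) \<longlonglongrightarrow> matrix_inv \<Theta>"
    proof (intro vec_tendstoI)
      fix a b
      show "(\<lambda>k. \<Sigma> k \<omega> $ a $ b) \<longlonglongrightarrow> matrix_inv \<Theta> $ a $ b"
        unfolding sym_mats_polarization[OF symS, folded e_def] sym_mats_polarization[OF symI, folded e_def]
        by (intro tendsto_intros forms) auto
    qed
  qed
qed

end

lemma exit_time_infinite: "exit_time A X = \<infinity> \<Longrightarrow> X k \<in> A"
proof (rule ccontr)
  assume inf: "exit_time A X = \<infinity>" and "X k \<notin> A"
  then have "exit_time A X \<le> enat k" unfolding exit_time_def by (intro Inf_lower) auto
  with inf show False by simp
qed

theorem theorem9:
  fixes M :: "'w measure" and F :: "nat \<Rightarrow> 'w measure"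
    and S \<theta>0 \<Sigma>0 \<theta>_hat :: "real ^ 'n ^ 'n"
    and lam \<alpha> \<gamma> l \<psi> :: real
    and \<zeta> :: "nat \<Rightarrow> real"
    and N :: nat
    and z :: "nat \<Rightarrow> nat \<Rightarrow> 'w \<Rightarrow> real ^ 'n"
    and \<Sigma> \<theta> :: "nat \<Rightarrow> 'w \<Rightarrow> real ^ 'n ^ 'n"
  assumes "S \<in> pos_semidef_mats"
    and "0 < lam" and "0 < \<alpha>" and "\<alpha> \<le> 1"
    and "1 \<le> N"
    and "\<theta>0 \<in> pos_def_mats" and "\<Sigma>0 \<in> pos_def_mats"
    and "stoch_prox_process M F S lam \<alpha> \<gamma> \<zeta> N \<theta>0 \<Sigma>0 z \<Sigma> \<theta>"
    and "\<And>k. 1 \<le> k \<Longrightarrow> 0 < \<zeta> k"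
    and "filterlim (\<lambda>n. \<Sum>k=1..n. \<zeta> k) at_top sequentially"
    and "summable (\<lambda>k. (\<zeta> (Suc k))\<^sup>2)"
    and "is_arg_min (objective S lam \<alpha>) (\<lambda>A. A \<in> pos_def_mats) \<theta>_hat"
    and "0 < l" and "l \<le> \<psi>"
    and "\<theta>_hat \<in> pos_def_between l \<psi>" and "\<theta>0 \<in> pos_def_between l \<psi>"
    and "0 < \<gamma>" and "\<gamma> \<le> l\<^sup>2"
  shows "AE \<omega> in M.
    exit_time (pos_def_between l \<psi>) (\<lambda>k. \<theta> k \<omega>) = \<infinity> \<and> convergent (\<lambda>k. \<theta> k \<omega>) \<longrightarrow>
    (\<lambda>k. \<theta> k \<omega>) \<longlonglongrightarrow> \<theta>_hat"
proof -
  interpret stoch_prox_process M F S lam \<alpha> \<gamma> \<zeta> N \<theta>0 \<Sigma>0 z \<Sigma> \<theta> by (rule assms(8))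
  have \<Sigma>0: "\<Sigma>0 \<in> sym_mats" using assms(7) by (simp add: pos_def_mats_def)
  have S: "S \<in> sym_mats" using assms(1) by (simp add: pos_semidef_mats_def)
  have lam: "0 \<le> lam" "0 \<le> \<alpha>" using assms(2,3) by auto
  let ?K = "pos_def_between l \<psi> :: (real ^ 'n ^ 'n) set" and ?g = "elastic_net lam \<alpha>"
  have "AE \<omega> in M. \<forall>\<Theta>. (\<forall>k. \<theta> k \<omega> \<in> ?K) \<longrightarrow> (\<lambda>k. \<theta> k \<omega>) \<longlonglongrightarrow> \<Theta> \<longrightarrow>
      (\<lambda>k. \<Sigma> k \<omega>) \<longlonglongrightarrow> matrix_inv \<Theta>"
    by (rule covariance_tracks[OF \<open>0 < l\<close> assms(5,11) _ assms(10) \<Sigma>0]) (rule assms(9))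
  then show ?thesis
    using AE_space
  proof (eventually_elim, intro impI, elim conjE)
    fix \<omega>
    assume tracks: "\<forall>\<Theta>. (\<forall>k. \<theta> k \<omega> \<in> ?K) \<longrightarrow> (\<lambda>k. \<theta> k \<omega>) \<longlonglongrightarrow> \<Theta> \<longrightarrow> (\<lambda>k. \<Sigma> k \<omega>) \<longlonglongrightarrow> matrix_inv \<Theta>"
      and \<omega>: "\<omega> \<in> space M" and exit: "exit_time ?K (\<lambda>k. \<theta> k \<omega>) = \<infinity>"
      and "convergent (\<lambda>k. \<theta> k \<omega>)"
    then obtain \<Theta> where lim: "(\<lambda>k. \<theta> k \<omega>) \<longlonglongrightarrow> \<Theta>" by (auto simp: convergent_def)
    have stay: "\<theta> k \<omega> \<in> ?K" for k using exit_time_infinite[OF exit] .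
    have \<Theta>K: "\<Theta> \<in> ?K"
      by (rule closed_sequentially[OF closed_pos_def_between[OF \<open>0 < l\<close>] stay lim])
    then have \<Theta>: "\<Theta> \<in> pos_def_mats" by (simp add: pos_def_between_def)
    have PD: "\<forall>j\<le>k. \<theta> j \<omega> \<in> pos_def_mats" for k using stay by (simp add: pos_def_between_def)
    have "(\<lambda>k. \<Sigma> k \<omega>) \<longlonglongrightarrow> matrix_inv \<Theta>" using tracks stay lim by blast
    then have \<Sigma>_lim: "(\<lambda>k. \<Sigma> (Suc k) \<omega>) \<longlonglongrightarrow> matrix_inv \<Theta>" by (rule LIMSEQ_Suc)
    have \<theta>_Suc: "(\<lambda>k. \<theta> (Suc k) \<omega>) \<longlonglongrightarrow> \<Theta>" using lim by (rule LIMSEQ_Suc)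
    \<comment> \<open>The gradient at \<Theta> of the smooth part of the objective, with the inverse
      obtained as the limit of the averages.\<close>
    define G where "G = S - matrix_inv \<Theta>"
    define A where "A k = \<theta> k \<omega> - \<gamma> *\<^sub>R (S - \<Sigma> (Suc k) \<omega>)" for k
    have A: "A \<longlonglongrightarrow> \<Theta> - \<gamma> *\<^sub>R G"
      unfolding A_def G_def by (intro tendsto_intros lim \<Sigma>_lim)
    \<comment> \<open>The limit is taken in the minimality inequality of each proximal step against
      a fixed competitor V, so continuity of the penalty is enough and none is asked of
      \<open>prox\<close>.\<close>
    have opt: "?g \<Theta> + 1 / (2 * \<gamma>) * (norm (\<Theta> - (\<Theta> - \<gamma> *\<^sub>R G)))\<^sup>2
        \<le> ?g V + 1 / (2 * \<gamma>) * (norm (V - (\<Theta> - \<gamma> *\<^sub>R G)))\<^sup>2" if V: "V \<in> sym_mats" for V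
    proof (rule LIMSEQ_le)
      show "(\<lambda>k. ?g (\<theta> (Suc k) \<omega>) + 1 / (2 * \<gamma>) * (norm (\<theta> (Suc k) \<omega> - A k))\<^sup>2)
          \<longlonglongrightarrow> ?g \<Theta> + 1 / (2 * \<gamma>) * (norm (\<Theta> - (\<Theta> - \<gamma> *\<^sub>R G)))\<^sup>2"
        by (intro tendsto_intros tendsto_elastic_net \<theta>_Suc A)
      show "(\<lambda>k. ?g V + 1 / (2 * \<gamma>) * (norm (V - A k))\<^sup>2)
          \<longlonglongrightarrow> ?g V + 1 / (2 * \<gamma>) * (norm (V - (\<Theta> - \<gamma> *\<^sub>R G)))\<^sup>2"
        by (intro tendsto_intros A)
      show "\<exists>N. \<forall>k\<ge>N. ?g (\<theta> (Suc k) \<omega>) + 1 / (2 * \<gamma>) * (norm (\<theta> (Suc k) \<omega> - A k))\<^sup>2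
          \<le> ?g V + 1 / (2 * \<gamma>) * (norm (V - A k))\<^sup>2"
        unfolding \<theta>_step[OF \<omega> PD] A_def[symmetric]
        using prox_optimal[OF lam assms(4,17) V] by blast
    qed
    have "\<theta>_hat = \<Theta>"
    proof (rule ccontr)
      assume ne: "\<theta>_hat \<noteq> \<Theta>"
      have hat: "\<theta>_hat \<in> pos_def_mats" using assms(12) by (simp add: is_arg_min_def)
      have "?g \<Theta> \<le> ?g \<theta>_hat + G \<bullet> (\<theta>_hat - \<Theta>)"
        by (rule prox_fixed_point_ineq[OF lam assms(4,17) _ _ opt])
          (use \<Theta> hat in \<open>auto simp: pos_def_mats_def\<close>)
      then have "objective S lam \<alpha> \<Theta> < objective S lam \<alpha> \<theta>_hat"
        unfolding G_def by (rule objective_less[OF S \<Theta> hat ne])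
      then show False using assms(12) \<Theta> by (auto simp: is_arg_min_def)
    qed
    with lim show "(\<lambda>k. \<theta> k \<omega>) \<longlonglongrightarrow> \<theta>_hat" by simp
  qed
qed

end
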